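(* Let $$A_\infty=\begin{pmatrix} b_0&c_1&&&\\ a_1&b_1&c_2&&\\ &a_2&b_2&c_3&\\ &&\ddots&\ddots&\ddots\end{pmatrix}$$ be an infinite complex (not necessarily symmetric) Jacobi matrix with bounded entries, $\sup_n(|a_n|+|b_n|+|c_n|)<\infty$, and let $A_n$ be its principal (leading) $n\times n$ block. Assume that $$\lim_{n\to\infty}\frac1n\sum_{j=1}^n\bigl(|1-a_j|+|b_j|+|1-c_j|\bigr)=0.$$ Then $\{A_n\}\sim_\lambda(2\cos t,[-\pi,\pi])$, $\{A_n\}$ is weakly clustered at $[-2,2]$, and every point $s\in[-2,2]$ strongly attracts $\{A_n\}$ with infinite order.
   Context: A matrix sequence $\{A_n\}$ is a sequence of complex matrices with $A_n$ of size $n\times n$; $\lambda_1(A_n),\dots,\lambda_n(A_n)$ are its eigenvalues counted with multiplicity. Distribution: $\{A_n\}\sim_\lambda(\theta,G)$ (distributed as $(\theta,G)$ in the sense of eigenvalues), for a measurable function $\theta$ on a set $G$ of finite positive Lebesgue measure $m(G)$, means that for every continuous $F:\mathbb C\to\mathbb C$ with bounded support, $$\lim_{n\to\infty}\frac1n\sum_{j=1}^nF(\lambda_j(A_n))=\frac1{m(G)}\int_GF(\theta(t))\,dt.$$ Weak clustering: for a nonempty closed $S\subset\mathbb C$ and $\varepsilon>0$ let $D(S,\varepsilon)=\bigcup_{s\in S}\{z\in\mathbb C:|z-s|<\varepsilon\}$. $\{A_n\}$ is weakly clustered at $S$ if for every $\varepsilon>0$ the number of indices $j$ with $\lambda_j(A_n)\notin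 D(S,\varepsilon)$ is $o(n)$ as $n\to\infty$. Attraction: a point $s\in\mathbb C$ strongly attracts $\{A_n\}$ with infinite order if, ordering the eigenvalues so that $|\lambda_1(A_n)-s|\le\cdots\le|\lambda_n(A_n)-s|$, one has $\lim_{n\to\infty}|\lambda_j(A_n)-s|=0$ for every fixed $j$. *)

theory Defs
  imports
    "HOL-Analysis.Analysis"
    "HOL-Library.Landau_Symbols"
    "Jordan_Normal_Form.Char_Poly"
begin

text \<open>Eigenvalues are counted with algebraic multiplicity, so \<open>A n\<close> of size \<open>n \<times> n\<close> has exactly
  \<open>n\<close> of them. Matrix sequences are functions \<open>A :: nat \<Rightarrow> complex mat\<close> where \<open>A n\<close> is \<open>n \<times> n\<close>;
  the degenerate term \<open>A 0\<close> plays no role in any of the limits below.\<close>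

definition eigvals_mset :: "complex mat \<Rightarrow> complex multiset" where
  "eigvals_mset M = proots (char_poly M)"

definition eigval_distributed ::
    "(nat \<Rightarrow> complex mat) \<Rightarrow> ('a::euclidean_space \<Rightarrow> complex) \<Rightarrow> 'a set \<Rightarrow> bool" where
  "eigval_distributed A \<theta> G \<longleftrightarrow>
     G \<in> sets lebesgue \<and> 0 < emeasure lebesgue G \<and> emeasure lebesgue G < \<infinity> \<and>
     \<theta> \<in> borel_measurable (lebesgue_on G) \<and>
     (\<forall>F :: complex \<Rightarrow> complex. continuous_on UNIV F \<longrightarrow> bounded {z. F z \<noteq> 0} \<longrightarrow>
        (\<lambda>n. (1 / of_nat n) * (\<Sum>z\<in>#eigvals_mset (A n). F z))
          \<longlonglongrightarrow> (1 / of_real (measure lebesgue G)) * (LINT t|lebesgue_on G. F (\<theta> t)))"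

definition nbhd :: "complex set \<Rightarrow> real \<Rightarrow> complex set" where
  "nbhd S \<epsilon> = (\<Union>s\<in>S. {z. cmod (z - s) < \<epsilon>})"

definition weakly_clustered :: "(nat \<Rightarrow> complex mat) \<Rightarrow> complex set \<Rightarrow> bool" where
  "weakly_clustered A S \<longleftrightarrow>
     S \<noteq> {} \<and> closed S \<and>
     (\<forall>\<epsilon>>0. (\<lambda>n. real (size {#z \<in># eigvals_mset (A n). z \<notin> nbhd S \<epsilon>#})) \<in> o(\<lambda>n. real n))"

text \<open>\<open>L n\<close> lists the eigenvalues of \<open>A n\<close> by increasing distance to \<open>s\<close>. Such a list always exists,
  and the distances do not depend on how ties are broken. List positions start at 0, and
  \<open>L n ! j\<close> is unspecified only for the finitely many \<open>n \<le> j\<close>.\<close>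

definition strongly_attracts_inf :: "complex \<Rightarrow> (nat \<Rightarrow> complex mat) \<Rightarrow> bool" where
  "strongly_attracts_inf s A \<longleftrightarrow>
     (\<forall>L :: nat \<Rightarrow> complex list.
        (\<forall>n. mset (L n) = eigvals_mset (A n) \<and> sorted (map (\<lambda>z. cmod (z - s)) (L n))) \<longrightarrow>
        (\<forall>j. (\<lambda>n. cmod (L n ! j - s)) \<longlonglongrightarrow> 0))"

text \<open>Rows and columns are indexed from 0; the values \<open>a 0\<close> and \<open>c 0\<close> do not occur in the matrix.\<close>

definition jacobi ::
    "(nat \<Rightarrow> complex) \<Rightarrow> (nat \<Rightarrow> complex) \<Rightarrow> (nat \<Rightarrow> complex) \<Rightarrow> nat \<Rightarrow> nat \<Rightarrow> complex" where
  "jacobi a b c i j =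
     (if i = j then b i else if i = Suc j then a i else if j = Suc i then c j else 0)"

definition leading_block :: "(nat \<Rightarrow> nat \<Rightarrow> complex) \<Rightarrow> nat \<Rightarrow> complex mat" where
  "leading_block M n = Matrix.mat n n (\<lambda>(i, j). M i j)"

end

theory Submission
  imports Defs "Jordan_Normal_Form.Schur_Decomposition"
begin

text \<open>Write \<open>T n\<close> for the free Jacobi block (ones on both off-diagonals, zeros on the diagonal). It is
Hermitian, its eigenvalues are \<open>2 cos (j \<pi> / (n + 1))\<close>, and averages of a continuous function over
them are Riemann sums, so \<open>T n\<close> has the distribution \<open>2 cos t\<close> on \<open>[-\<pi>, \<pi>]\<close>. The hypothesis says
that the entries of \<open>A n - T n\<close> have absolute sum \<open>o(n)\<close>, and the point is to see that such a
perturbation, which need be neither Hermitian nor small in operator norm, does not change limits of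
averages over eigenvalues (\<open>eigenvalue_averages_asymptotically_equal\<close>).

Power sums of eigenvalues are traces of powers, and \<open>tr (A\<^sup>k) - tr (T\<^sup>k)\<close> is bounded by a constant
times the entry sum of \<open>A - T\<close>; this settles polynomial test functions. Complex polynomials do not
approximate all continuous functions on a disc, so moments alone cannot suffice. What
rescues the argument is that the eigenvalues of \<open>A n\<close> are almost real: in a unitary
triangularization \<open>U\<^sup>* A U\<close> the diagonal carries the eigenvalues, and since \<open>U\<^sup>* T U\<close> has a real
diagonal, their imaginary parts come from \<open>U\<^sup>* (A - T) U\<close> alone. Hence the sum of \<open>|Im \<lambda>|\<close> is at
most the entry sum of \<open>A - T\<close>, again \<open>o(n)\<close> (\<open>sum_abs_Im_eigvals_le\<close>). A continuous function is
within \<open>\<epsilon> + K |Im z|\<close> of some polynomial on a disc (\<open>polynomial_approx_near_real_axis\<close>), so the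
polynomial case implies the general one.

The other two claims are formal consequences of the distribution, tested on tent functions. A tent
that is 1 on \<open>[-2, 2]\<close> and vanishes off its \<open>\<epsilon>\<close>-neighbourhood has limiting average 1, so only \<open>o(n)\<close>
eigenvalues lie outside. A tent around a point \<open>s\<close> of \<open>[-2, 2]\<close> has a positive limiting average, so
the number of eigenvalues near \<open>s\<close> grows linearly in \<open>n\<close>.\<close>

section \<open>Unitary triangularization\<close>

lemma mat_adjoint_dims [simp]:
  "dim_row (mat_adjoint A) = dim_col A" "dim_col (mat_adjoint A) = dim_row A"
  by (simp_all add: mat_adjoint_def)

lemma mat_adjoint_index [simp]:
  fixes A :: "complex mat"
  assumes "i < dim_col A" "j < dim_row A"
  shows "mat_adjoint A $$ (i, j) = cnj (A $$ (j, i))"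
  using assms by (simp add: mat_adjoint_def mat_of_rows_index)

lemma mat_adjoint_carrier [simp]: "A \<in> carrier_mat n m \<Longrightarrow> mat_adjoint A \<in> carrier_mat m n"
  using carrier_matI[of "mat_adjoint A" m n] by simp

lemma mat_adjoint_mult:
  fixes A B :: "complex mat"
  assumes "A \<in> carrier_mat n m" "B \<in> carrier_mat m k"
  shows "mat_adjoint (A * B) = mat_adjoint B * mat_adjoint A"
proof (rule eq_matI)
  fix i j assume "i < dim_row (mat_adjoint B * mat_adjoint A)" "j < dim_col (mat_adjoint B * mat_adjoint A)"
  then have ij: "i < k" "j < n" using assms by auto
  then show "mat_adjoint (A * B) $$ (i, j) = (mat_adjoint B * mat_adjoint A) $$ (i, j)"
    using assms by (simp add: scalar_prod_def cnj_sum mult.commute)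
qed (use assms in auto)

lemma mat_adjoint_direct_sum_one:
  fixes B :: "complex mat"
  assumes "B \<in> carrier_mat m m"
  shows "mat_adjoint (four_block_mat (1\<^sub>m 1) (0\<^sub>m 1 m) (0\<^sub>m m 1) B)
    = four_block_mat (1\<^sub>m 1) (0\<^sub>m 1 m) (0\<^sub>m m 1) (mat_adjoint B)"
    (is "mat_adjoint ?L = ?R")
proof (rule eq_matI)
  fix i j assume "i < dim_row ?R" "j < dim_col ?R"
  then have ij: "i < Suc m" "j < Suc m" using assms by simp_all
  then show "mat_adjoint ?L $$ (i, j) = ?R $$ (i, j)"
    using assms by (cases i; cases j) simp_all
qed (use assms in simp_all)

text \<open>Gram-Schmidt only yields orthogonal vectors. Normalizing them makes the matrix that they form
unitary, and unlike column orthogonality, unitarity survives multiplication in the induction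
for the triangularization.\<close>

lemma orthonormal_completion:
  fixes v :: "complex Matrix.vec"
  assumes v: "v \<in> carrier_vec n" and v0: "v \<noteq> 0\<^sub>v n"
  obtains ws where "set ws \<subseteq> carrier_vec n" "corthogonal ws" "length ws = n"
    "\<And>w. w \<in> set ws \<Longrightarrow> w \<bullet>c w = 1" "hd ws = (1 / csqrt (v \<bullet>c v)) \<cdot>\<^sub>v v" "n \<noteq> 0"
proof -
  interpret cof_vec_space n "TYPE(complex)" .
  define b where "b = basis_completion v"
  from basis_completion[OF v v0, folded b_def]
  have dist_b: "distinct b"
    and indep: "\<not> lin_dep (set b)" and b: "set b \<subseteq> carrier_vec n" and hdb: "hd b = v"
    and len_b: "length b = n" by auto
  have n: "n \<noteq> 0" using v v0 by (intro notI) auto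
  from hdb len_b n obtain vs where bv: "b = v # vs" by (cases b, auto)
  define us where "us = gram_schmidt n b"
  from gram_schmidt_result[OF b dist_b indep refl, folded us_def]
  have us: "set us \<subseteq> carrier_vec n" "corthogonal us" "length us = n"
    by (auto simp: len_b)
  from gram_schmidt_hd[OF v, of vs, folded bv] have hdus: "hd us = v" unfolding us_def .
  define f where "f = (\<lambda>w :: complex Matrix.vec. (1 / csqrt (w \<bullet>c w)) \<cdot>\<^sub>v w)"
  have nz: "w \<bullet>c w \<noteq> 0" if "w \<in> set us" for w
    using that us(2) unfolding corthogonal_def in_set_conv_nth by auto
  have fc: "f w \<bullet>c f w' = (1 / csqrt (w \<bullet>c w)) * cnj (1 / csqrt (w' \<bullet>c w')) * (w \<bullet>c w')"
    if "w \<in> carrier_vec n" "w' \<in> carrier_vec n" for w w'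
    using that by (simp add: f_def conjugate_smult_vec)
  have ff: "f w \<bullet>c f w = 1" if "w \<in> set us" for w
  proof -
    have wc: "w \<in> carrier_vec n" using that us by auto
    define q where "q = w \<bullet>c w"
    have q0: "q \<ge> 0" unfolding q_def using conjugate_square_ge_0_vec .
    then obtain r where r: "q = of_real r" "r \<ge> 0"
      by (metis less_eq_complex_def complex_eq_iff Im_complex_of_real Re_complex_of_real zero_complex.sel)
    have "r > 0" using r nz[OF that] q_def by (cases "r = 0") auto
    then show ?thesis
      using r unfolding fc[OF wc wc] q_def[symmetric]
      by (simp flip: of_real_mult of_real_divide add: r(1))
  qed
  show thesis
  proof (rule that[of "map f us"])
    show "set (map f us) \<subseteq> carrier_vec n" using us by (auto simp: f_def)
    show "length (map f us) = n" using us by simp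
    show "w \<bullet>c w = 1" if "w \<in> set (map f us)" for w using that ff by auto
    have usn: "us \<noteq> []" using us(3) n by auto
    then show "hd (map f us) = (1 / csqrt (v \<bullet>c v)) \<cdot>\<^sub>v v"
      by (simp add: hd_map hdus f_def)
    show "n \<noteq> 0" by fact
    show "corthogonal (map f us)"
    proof
      fix i j assume ij: "i < length (map f us)" "j < length (map f us)"
      have m: "us ! i \<in> set us" "us ! j \<in> set us" using ij by auto
      have c: "us ! i \<in> carrier_vec n" "us ! j \<in> carrier_vec n" using m us by auto
      show "(map f us ! i \<bullet>c map f us ! j = 0) = (i \<noteq> j)"
        using ij corthogonalD[OF us(2), of i j] nz[OF m(1)] nz[OF m(2)]
        by (simp add: fc[OF c])
    qed
  qed
qed

text \<open>Schur's theorem by deflation: a unit eigenvector, completed to an orthonormal basis, splits off the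
first eigenvalue, and the remaining block is triangularized by induction. Unitarity of \<open>U\<close> is
essential for the estimate on imaginary parts, where both the rows of \<open>U\<close> have norm 1 and
conjugation by \<open>U\<close> preserves Hermitian matrices.\<close>

theorem unitary_schur_decomposition:
  fixes A :: "complex mat"
  assumes "A \<in> carrier_mat n n" "char_poly A = (\<Prod>e\<leftarrow>es. [:- e, 1:])"
  shows "\<exists>U \<in> carrier_mat n n. mat_adjoint U * U = 1\<^sub>m n \<and>
    upper_triangular (mat_adjoint U * A * U) \<and> diag_mat (mat_adjoint U * A * U) = es"
  using assms
proof (induction es arbitrary: n A)
  case Nil
  with degree_monic_char_poly[of A n] have "n = 0" by auto
  then show ?case using Nil by (intro bexI[of _ "1\<^sub>m 0"]) (auto simp: diag_mat_def)
next
  case (Cons e es n A)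
  note A = Cons.prems(1)
  let ?m = "n - 1"
  have cp: "char_poly A = [:- e, 1:] * (\<Prod>e\<leftarrow>es. [:- e, 1:])" using Cons.prems by simp
  have "eigenvalue A e" unfolding eigenvalue_root_char_poly[OF A] cp by simp
  then obtain v where v: "v \<in> carrier_vec n" "v \<noteq> 0\<^sub>v n" "A *\<^sub>v v = e \<cdot>\<^sub>v v"
    using A unfolding eigenvalue_def eigenvector_def by auto
  obtain ws where ws: "set ws \<subseteq> carrier_vec n" "corthogonal ws" "length ws = n"
    and unit: "\<And>w. w \<in> set ws \<Longrightarrow> w \<bullet>c w = 1"
    and hd: "hd ws = (1 / csqrt (v \<bullet>c v)) \<cdot>\<^sub>v v" and n: "n \<noteq> 0"
    using orthonormal_completion[OF v(1,2)] by blast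
  define u where "u = (1 / csqrt (v \<bullet>c v)) \<cdot>\<^sub>v v"
  have u: "u \<in> carrier_vec n" using v by (simp add: u_def)
  have "u \<noteq> 0\<^sub>v n"
  proof
    assume "u = 0\<^sub>v n"
    moreover have "u \<in> set ws" using hd u_def ws(3) n by (metis hd_in_set length_0_conv)
    ultimately show False using unit[of u] by simp
  qed
  have Au: "A *\<^sub>v u = e \<cdot>\<^sub>v u"
    unfolding u_def using mult_mat_vec[OF A v(1)] v(3)
    by (simp add: smult_smult_assoc mult.commute)
  define W where "W = mat_of_cols n ws"
  have W: "W \<in> carrier_mat n n" using ws unfolding W_def using mat_of_cols_carrier(1)[of n ws] by auto
  have orth_W: "corthogonal_mat W" using orthogonal_mat_of_cols ws unfolding W_def .
  \<comment> \<open>For columns of norm 1 the inverse of an orthogonal matrix is its adjoint.\<close>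
  have adjW: "corthogonal_inv W = mat_adjoint W"
  proof -
    have "cols W = ws" unfolding W_def using ws(1) by (rule cols_mat_of_cols)
    then have "map vec_inv (cols W) = map conjugate (cols W)"
      using unit by (auto simp: vec_inv_def)
    then show ?thesis unfolding corthogonal_inv_def mat_adjoint_def by (rule arg_cong)
  qed
  have W': "mat_adjoint W \<in> carrier_mat n n" using W by simp
  have W'W: "mat_adjoint W * W = 1\<^sub>m n"
    using corthogonal_inv_result[OF orth_W] W unfolding adjW inverts_mat_def by simp
  have WW': "W * mat_adjoint W = 1\<^sub>m n" using mat_mult_left_right_inverse[OF W' W W'W] .
  define A' where "A' = mat_adjoint W * A * W"
  have A': "A' \<in> carrier_mat n n" using W W' A unfolding A'_def by auto
  have col0: "Matrix.col A' 0 = Matrix.vec n (\<lambda>i. if i = 0 then e else 0)"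
    using corthogonal_col_ev_0[OF A u \<open>u \<noteq> 0\<^sub>v n\<close> Au n hd[folded u_def] ws, folded W_def, unfolded adjW]
    unfolding A'_def .
  obtain A1 A2 A0 A3 where split: "split_block A' 1 1 = (A1, A2, A0, A3)"
    by (cases "split_block A' 1 1") auto
  from A' n have "dim_row A' = 1 + ?m" "dim_col A' = 1 + ?m" by auto
  from split_block[OF split this] have A2: "A2 \<in> carrier_mat 1 ?m"
    and A3: "A3 \<in> carrier_mat ?m ?m" and A'block: "A' = four_block_mat A1 A2 A0 A3" by auto
  have A1id: "A1 = Matrix.mat 1 1 (\<lambda>_. e)"
    using split[unfolded split_block_def Let_def] arg_cong[OF col0, of "\<lambda>v. vec_index v 0"] A' n
    by (auto simp: col_def)
  have "A' $$ (Suc i, 0) = 0" if "i < ?m" for i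
    using that arg_cong[OF col0, of "\<lambda>v. vec_index v (Suc i)"] A' by auto
  then have A0id: "A0 = 0\<^sub>m ?m 1"
    using split[unfolded split_block_def Let_def] A' by auto
  have A1: "A1 \<in> carrier_mat 1 1" unfolding A1id by auto
  have A0: "A0 \<in> carrier_mat ?m 1" unfolding A0id by auto
  have "similar_mat_wit A' A (mat_adjoint W) W"
    by (rule similar_mat_witI[of _ _ n], insert W W' A A' W'W WW', auto simp: A'_def)
  then have "char_poly A' = char_poly A"
    by (intro char_poly_similar) (auto simp: similar_mat_def)
  moreover have "char_poly A' = char_poly A1 * char_poly A3"
    unfolding A'block A0id by (rule char_poly_four_block_zeros_col[OF A1 A2 A3])
  moreover have "char_poly A1 = [:- e, 1:]"
    by (simp add: A1id char_poly_defs Determinant.det_def sign_def)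
  ultimately have "char_poly A3 = (\<Prod>e\<leftarrow>es. [:- e, 1:])"
    using cp by (metis mult_cancel_left pCons_eq_0_iff zero_neq_one)
  from Cons.IH[OF A3 this] obtain U3 where U3: "U3 \<in> carrier_mat ?m ?m"
    "mat_adjoint U3 * U3 = 1\<^sub>m ?m" "upper_triangular (mat_adjoint U3 * A3 * U3)"
    "diag_mat (mat_adjoint U3 * A3 * U3) = es" by blast
  define D where "D = four_block_mat (1\<^sub>m 1) (0\<^sub>m 1 ?m) (0\<^sub>m ?m 1) U3"
  have D: "D \<in> carrier_mat n n" unfolding D_def using U3 n
    by (metis One_nat_def Suc_pred four_block_carrier_mat neq0_conv one_carrier_mat plus_1_eq_Suc)
  have adjD: "mat_adjoint D = four_block_mat (1\<^sub>m 1) (0\<^sub>m 1 ?m) (0\<^sub>m ?m 1) (mat_adjoint U3)"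
    unfolding D_def by (rule mat_adjoint_direct_sum_one[OF U3(1)])
  have D': "mat_adjoint D \<in> carrier_mat n n" using D by simp
  have one: "1\<^sub>m n = four_block_mat (1\<^sub>m 1) (0\<^sub>m 1 ?m) (0\<^sub>m ?m 1) (1\<^sub>m ?m :: complex mat)"
    using n by (intro eq_matI) auto
  have U3': "mat_adjoint U3 \<in> carrier_mat ?m ?m" and B3: "mat_adjoint U3 * A3 \<in> carrier_mat ?m ?m"
    and z: "0\<^sub>m ?m 1 \<in> carrier_mat ?m 1" "0\<^sub>m 1 ?m \<in> carrier_mat 1 ?m"
    and o: "1\<^sub>m 1 \<in> carrier_mat 1 1"
    using U3(1) A3 by auto
  note mult_block = mult_four_block_mat[of _ 1 1 _ ?m _ ?m _ _ 1 _ ?m]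
  have D'D: "mat_adjoint D * D = 1\<^sub>m n"
    unfolding adjD unfolding D_def one
    by (subst mult_block[OF o z(2,1) U3' o z(2,1) U3(1)])
      (use U3(1,2) in \<open>simp add: left_add_zero_mat[of _ ?m ?m]\<close>)
  have DAD: "mat_adjoint D * A' * D
    = four_block_mat A1 (A2 * U3) (0\<^sub>m ?m 1) (mat_adjoint U3 * A3 * U3)"
  proof -
    have "mat_adjoint D * A' = four_block_mat A1 A2 (0\<^sub>m ?m 1) (mat_adjoint U3 * A3)"
      unfolding adjD A'block A0id
      by (subst mult_block[OF o z(2,1) U3' A1 A2 z(1) A3])
        (use A1 A2 A3 U3' B3 in \<open>simp add: left_add_zero_mat[of _ ?m ?m] right_mult_zero_mat[of _ ?m ?m] del: One_nat_def\<close>)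
    then show ?thesis unfolding D_def
      by (simp only: mult_block[OF A1 A2 z(1) B3 o z(2,1) U3(1)])
        (use A1 A2 A3 U3 B3 in \<open>simp add: left_add_zero_mat[of _ ?m ?m]\<close>)
  qed
  define U where "U = W * D"
  have U: "U \<in> carrier_mat n n" using W D by (simp add: U_def)
  have adjU: "mat_adjoint U = mat_adjoint D * mat_adjoint W"
    unfolding U_def by (rule mat_adjoint_mult[OF W D])
  have UU: "mat_adjoint U * U = 1\<^sub>m n"
  proof -
    have "mat_adjoint U * U = mat_adjoint D * ((mat_adjoint W * W) * D)"
      unfolding adjU unfolding U_def using W W' D D'
      by (simp add: assoc_mult_mat[of _ n n _ n _ n] mult_carrier_mat[of _ n n _ n])
    then show ?thesis using W'W D D'D by simp
  qed
  have UAU: "mat_adjoint U * A * U = mat_adjoint D * A' * D"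
    unfolding adjU unfolding U_def A'_def using W W' D D' A
    by (simp add: assoc_mult_mat[of _ n n _ n _ n] mult_carrier_mat[of _ n n _ n])
  have C3: "mat_adjoint U3 * A3 * U3 \<in> carrier_mat ?m ?m" using U3 A3 by auto
  have "upper_triangular (mat_adjoint U * A * U)"
    unfolding UAU DAD by (rule upper_triangular_four_block[OF A1 C3 _ U3(3)]) (auto simp: A1id)
  moreover have "diag_mat (mat_adjoint U * A * U) = e # es"
    unfolding UAU DAD diag_four_block_mat[OF A1 C3] U3(4) by (simp add: A1id diag_mat_def)
  ultimately show ?case using U UU by blast
qed

section \<open>The entrywise norm and powers of matrices\<close>

lemma mult_mat_index:
  assumes "A \<in> carrier_mat n m" "B \<in> carrier_mat m k" "i < n" "j < k"
  shows "(A * B) $$ (i, j) = (\<Sum>l = 0..<m. A $$ (i, l) * B $$ (l, j))"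
  using assms by (simp add: scalar_prod_def)

text \<open>An upper bound for the trace norm that needs no singular values: it dominates both the trace and
the sum of \<open>|\<langle>A u\<^sub>j, u\<^sub>j\<rangle>|\<close> over any orthonormal basis.\<close>

definition entry_norm :: "complex mat \<Rightarrow> real" where
  "entry_norm A = (\<Sum>i = 0..<dim_row A. \<Sum>j = 0..<dim_col A. cmod (A $$ (i, j)))"

text \<open>Row and column sums are the operator norms on \<open>\<ell>\<^sup>\<infinity>\<close> and \<open>\<ell>\<^sup>1\<close>; they are the bounds under which
multiplication from the right and from the left acts on the entrywise norm.\<close>

definition row_sums_le :: "complex mat \<Rightarrow> real \<Rightarrow> bool" where
  "row_sums_le A C \<longleftrightarrow> (\<forall>i < dim_row A. (\<Sum>j = 0..<dim_col A. cmod (A $$ (i, j))) \<le> C)"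

definition col_sums_le :: "complex mat \<Rightarrow> real \<Rightarrow> bool" where
  "col_sums_le A C \<longleftrightarrow> (\<forall>j < dim_col A. (\<Sum>i = 0..<dim_row A. cmod (A $$ (i, j))) \<le> C)"

lemma entry_norm_nonneg: "0 \<le> entry_norm A"
  unfolding entry_norm_def by (intro sum_nonneg) auto

lemma entry_norm_add:
  assumes "A \<in> carrier_mat n m" "B \<in> carrier_mat n m"
  shows "entry_norm (A + B) \<le> entry_norm A + entry_norm B"
proof -
  have "entry_norm (A + B) = (\<Sum>i = 0..<n. \<Sum>j = 0..<m. cmod (A $$ (i, j) + B $$ (i, j)))"
    using assms by (simp add: entry_norm_def)
  also have "\<dots> \<le> (\<Sum>i = 0..<n. \<Sum>j = 0..<m. cmod (A $$ (i, j)) + cmod (B $$ (i, j)))"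
    by (intro sum_mono norm_triangle_ineq)
  also have "\<dots> = entry_norm A + entry_norm B"
    using assms by (simp add: entry_norm_def sum.distrib)
  finally show ?thesis .
qed

lemma entry_norm_mult_row_sums:
  assumes A: "A \<in> carrier_mat n m" and B: "B \<in> carrier_mat m k" and "row_sums_le B C"
  shows "entry_norm (A * B) \<le> entry_norm A * C"
proof -
  have "entry_norm (A * B) = (\<Sum>i = 0..<n. \<Sum>j = 0..<k. cmod (\<Sum>l = 0..<m. A $$ (i, l) * B $$ (l, j)))"
    unfolding entry_norm_def using A B by (simp add: mult_mat_index[OF A B] del: index_mult_mat(1))
  also have "\<dots> \<le> (\<Sum>i = 0..<n. \<Sum>j = 0..<k. \<Sum>l = 0..<m. cmod (A $$ (i, l)) * cmod (B $$ (l, j)))"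
    by (intro sum_mono order_trans[OF norm_sum]) (simp add: norm_mult)
  also have "\<dots> = (\<Sum>i = 0..<n. \<Sum>l = 0..<m. cmod (A $$ (i, l)) * (\<Sum>j = 0..<k. cmod (B $$ (l, j))))"
    unfolding sum_distrib_left by (intro sum.cong refl sum.swap)
  also have "\<dots> \<le> (\<Sum>i = 0..<n. \<Sum>l = 0..<m. cmod (A $$ (i, l)) * C)"
    using assms unfolding row_sums_le_def by (intro sum_mono mult_left_mono) auto
  also have "\<dots> = entry_norm A * C"
    using A by (simp add: entry_norm_def sum_distrib_right)
  finally show ?thesis .
qed

lemma entry_norm_mult_col_sums:
  assumes A: "A \<in> carrier_mat n m" and B: "B \<in> carrier_mat m k" and "col_sums_le A C"
  shows "entry_norm (A * B) \<le> C * entry_norm B"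
proof -
  have "entry_norm (A * B) = (\<Sum>i = 0..<n. \<Sum>j = 0..<k. cmod (\<Sum>l = 0..<m. A $$ (i, l) * B $$ (l, j)))"
    unfolding entry_norm_def using A B by (simp add: mult_mat_index[OF A B] del: index_mult_mat(1))
  also have "\<dots> \<le> (\<Sum>i = 0..<n. \<Sum>j = 0..<k. \<Sum>l = 0..<m. cmod (A $$ (i, l)) * cmod (B $$ (l, j)))"
    by (intro sum_mono order_trans[OF norm_sum]) (simp add: norm_mult)
  also have "\<dots> = (\<Sum>j = 0..<k. \<Sum>i = 0..<n. \<Sum>l = 0..<m. cmod (A $$ (i, l)) * cmod (B $$ (l, j)))"
    by (rule sum.swap)
  also have "\<dots> = (\<Sum>j = 0..<k. \<Sum>l = 0..<m. (\<Sum>i = 0..<n. cmod (A $$ (i, l))) * cmod (B $$ (l, j)))"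
    unfolding sum_distrib_right by (intro sum.cong refl sum.swap)
  also have "\<dots> \<le> (\<Sum>j = 0..<k. \<Sum>l = 0..<m. C * cmod (B $$ (l, j)))"
    using assms unfolding col_sums_le_def by (intro sum_mono mult_right_mono) auto
  also have "\<dots> = (\<Sum>l = 0..<m. \<Sum>j = 0..<k. C * cmod (B $$ (l, j)))"
    by (rule sum.swap)
  also have "\<dots> = C * entry_norm B"
    using B by (simp add: entry_norm_def sum_distrib_left)
  finally show ?thesis .
qed

lemma col_sums_le_mult:
  assumes A: "A \<in> carrier_mat n m" and B: "B \<in> carrier_mat m k"
    and "col_sums_le A C" "col_sums_le B D" "0 \<le> C"
  shows "col_sums_le (A * B) (C * D)"
  unfolding col_sums_le_def
proof (intro allI impI)
  fix j assume "j < dim_col (A * B)"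
  then have j: "j < k" using B by simp
  have "(\<Sum>i = 0..<dim_row (A * B). cmod ((A * B) $$ (i, j)))
      = (\<Sum>i = 0..<n. cmod (\<Sum>l = 0..<m. A $$ (i, l) * B $$ (l, j)))"
    using A B j by (simp add: mult_mat_index[OF A B] del: index_mult_mat(1))
  also have "\<dots> \<le> (\<Sum>i = 0..<n. \<Sum>l = 0..<m. cmod (A $$ (i, l)) * cmod (B $$ (l, j)))"
    by (intro sum_mono order_trans[OF norm_sum]) (simp add: norm_mult)
  also have "\<dots> = (\<Sum>l = 0..<m. (\<Sum>i = 0..<n. cmod (A $$ (i, l))) * cmod (B $$ (l, j)))"
    unfolding sum_distrib_right by (rule sum.swap)
  also have "\<dots> \<le> (\<Sum>l = 0..<m. C * cmod (B $$ (l, j)))"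
    using assms unfolding col_sums_le_def by (intro sum_mono mult_right_mono) auto
  also have "\<dots> = C * (\<Sum>l = 0..<m. cmod (B $$ (l, j)))" by (simp add: sum_distrib_left)
  also have "\<dots> \<le> C * D"
    using assms j unfolding col_sums_le_def by (intro mult_left_mono) auto
  finally show "(\<Sum>i = 0..<dim_row (A * B). cmod ((A * B) $$ (i, j))) \<le> C * D" .
qed

lemma col_sums_le_pow:
  assumes A: "A \<in> carrier_mat n n" and C: "col_sums_le A C" "0 \<le> C"
  shows "col_sums_le (A ^\<^sub>m k) (C ^ k)"
proof (induction k)
  case 0
  have "(\<Sum>i = 0..<n. cmod (1\<^sub>m n $$ (i, j))) = (\<Sum>i = 0..<n. if i = j then 1 else 0)" if "j < n" for j
    using that by (intro sum.cong) auto
  then show ?case using A by (simp add: col_sums_le_def)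
next
  case (Suc k)
  then show ?case
    using col_sums_le_mult[OF pow_carrier_mat[OF A] A Suc.IH C(1)] C(2) by (simp add: mult.commute)
qed

text \<open>Telescoping \<open>A\<^sup>k\<^sup>+\<^sup>1 - B\<^sup>k\<^sup>+\<^sup>1 = (A\<^sup>k - B\<^sup>k) A + B\<^sup>k (A - B)\<close>: the difference enters linearly, so a
perturbation of entry sum \<open>o(n)\<close> changes every fixed power by \<open>o(n)\<close>, uniformly in the
dimension.\<close>

lemma entry_norm_pow_diff:
  assumes A: "A \<in> carrier_mat n n" and B: "B \<in> carrier_mat n n"
    and C: "row_sums_le A C" "col_sums_le B C" "0 \<le> C"
  shows "entry_norm (A ^\<^sub>m k - B ^\<^sub>m k) \<le> real k * C ^ (k - 1) * entry_norm (A - B)"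
proof (induction k)
  case 0
  show ?case using A B by (simp add: entry_norm_def)
next
  case (Suc k)
  let ?D = "A ^\<^sub>m k - B ^\<^sub>m k"
  have Ak: "A ^\<^sub>m k \<in> carrier_mat n n" and Bk: "B ^\<^sub>m k \<in> carrier_mat n n" using A B by auto
  have D: "?D \<in> carrier_mat n n" and E: "A - B \<in> carrier_mat n n" using A B Ak Bk by auto
  have "A ^\<^sub>m Suc k - B ^\<^sub>m Suc k = ?D * A + B ^\<^sub>m k * (A - B)"
    unfolding minus_mult_distrib_mat[OF Ak Bk A] mult_minus_distrib_mat[OF Bk A B]
    using A B Ak Bk by (intro eq_matI) auto
  then have "entry_norm (A ^\<^sub>m Suc k - B ^\<^sub>m Suc k) \<le> entry_norm (?D * A) + entry_norm (B ^\<^sub>m k * (A - B))"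
    using entry_norm_add[OF mult_carrier_mat[OF D A] mult_carrier_mat[OF Bk E]] by simp
  also have "\<dots> \<le> entry_norm ?D * C + C ^ k * entry_norm (A - B)"
    by (intro add_mono entry_norm_mult_row_sums[OF D A C(1)]
        entry_norm_mult_col_sums[OF Bk E col_sums_le_pow[OF B C(2,3)]])
  also have "\<dots> \<le> real k * C ^ (k - 1) * entry_norm (A - B) * C + C ^ k * entry_norm (A - B)"
    using Suc.IH C(3) by (intro add_mono mult_right_mono order_refl)
  also have "\<dots> = real (Suc k) * C ^ (Suc k - 1) * entry_norm (A - B)"
    by (cases k) (auto simp: algebra_simps)
  finally show ?case .
qed

section \<open>Traces and eigenvalues\<close>

definition mat_trace :: "complex mat \<Rightarrow> complex" where
  "mat_trace A = (\<Sum>i = 0..<dim_row A. A $$ (i, i))"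

lemma mat_trace_mult_commute:
  assumes A: "A \<in> carrier_mat n m" and B: "B \<in> carrier_mat m n"
  shows "mat_trace (A * B) = mat_trace (B * A)"
proof -
  have "mat_trace (A * B) = (\<Sum>i = 0..<n. \<Sum>l = 0..<m. A $$ (i, l) * B $$ (l, i))"
    unfolding mat_trace_def using A B by (simp add: mult_mat_index[OF A B] del: index_mult_mat(1))
  also have "\<dots> = (\<Sum>l = 0..<m. \<Sum>i = 0..<n. B $$ (l, i) * A $$ (i, l))"
    by (subst sum.swap) (simp add: mult.commute)
  also have "\<dots> = mat_trace (B * A)"
    unfolding mat_trace_def using A B by (simp add: mult_mat_index[OF B A] del: index_mult_mat(1))
  finally show ?thesis .
qed

lemma mat_trace_similar:
  assumes "similar_mat_wit A B P Q"
  shows "mat_trace A = mat_trace B"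
proof -
  define n where "n = dim_row A"
  from similar_mat_witD[OF n_def assms] have P: "P \<in> carrier_mat n n" and Q: "Q \<in> carrier_mat n n"
    and B: "B \<in> carrier_mat n n" and QP: "Q * P = 1\<^sub>m n" and A: "A = P * B * Q" by auto
  have "mat_trace A = mat_trace (P * (B * Q))"
    using P B Q by (simp add: A assoc_mult_mat[of _ n n _ n _ n])
  also have "\<dots> = mat_trace ((B * Q) * P)"
    by (rule mat_trace_mult_commute[of _ n n]) (use P B Q in auto)
  also have "\<dots> = mat_trace B"
    using P B Q QP by (simp add: assoc_mult_mat[of _ n n _ n _ n])
  finally show ?thesis .
qed

lemma mat_trace_diff_le:
  assumes "A \<in> carrier_mat n n" "B \<in> carrier_mat n n"
  shows "cmod (mat_trace A - mat_trace B) \<le> entry_norm (A - B)"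
proof -
  have "cmod (mat_trace A - mat_trace B) = cmod (\<Sum>i = 0..<n. (A - B) $$ (i, i))"
    using assms by (simp add: mat_trace_def sum_subtractf)
  also have "\<dots> \<le> (\<Sum>i = 0..<n. cmod ((A - B) $$ (i, i)))" by (rule norm_sum)
  also have "\<dots> \<le> (\<Sum>i = 0..<n. \<Sum>j = 0..<n. cmod ((A - B) $$ (i, j)))"
    by (intro sum_mono member_le_sum) auto
  also have "\<dots> = entry_norm (A - B)" using assms by (simp add: entry_norm_def)
  finally show ?thesis .
qed

lemma upper_triangular_mult:
  fixes A B :: "complex mat"
  assumes A: "A \<in> carrier_mat n n" and B: "B \<in> carrier_mat n n"
    and ut: "upper_triangular A" "upper_triangular B"
  shows "upper_triangular (A * B)"
    and "i < n \<Longrightarrow> (A * B) $$ (i, i) = A $$ (i, i) * B $$ (i, i)"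
proof -
  have z: "A $$ (i, l) * B $$ (l, j) = 0" if "i < n" "j < n" "l < n" "l < i \<or> j < l" for i j l
    using that ut A B by (auto simp: upper_triangular_def)
  show "upper_triangular (A * B)"
    unfolding upper_triangular_def
  proof (intro allI impI)
    fix i j assume "i < dim_row (A * B)" "j < i"
    then have ij: "i < n" "j < n" "j < i" using A by auto
    have "(\<Sum>l = 0..<n. A $$ (i, l) * B $$ (l, j)) = 0"
      using ij z[of i j] by (intro sum.neutral ballI) force
    then show "(A * B) $$ (i, j) = 0" using ij by (simp add: mult_mat_index[OF A B] del: index_mult_mat(1))
  qed
  show "(A * B) $$ (i, i) = A $$ (i, i) * B $$ (i, i)" if i: "i < n"
  proof -
    have "(\<Sum>l = 0..<n. A $$ (i, l) * B $$ (l, i)) = (\<Sum>l \<in> {i}. A $$ (i, l) * B $$ (l, i))"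
      using i z[of i i] by (intro sum.mono_neutral_right) (auto simp: neq_iff)
    then show ?thesis using i by (simp add: mult_mat_index[OF A B] del: index_mult_mat(1))
  qed
qed

lemma upper_triangular_pow:
  fixes A :: "complex mat"
  assumes A: "A \<in> carrier_mat n n" and ut: "upper_triangular A"
  shows "upper_triangular (A ^\<^sub>m k) \<and> (\<forall>i < n. (A ^\<^sub>m k) $$ (i, i) = (A $$ (i, i)) ^ k)"
proof (induction k)
  case 0
  then show ?case using A by auto
next
  case (Suc k)
  then show ?case using upper_triangular_mult[OF pow_carrier_mat[OF A] A _ ut]
    by (simp add: mult.commute)
qed

lemma eigvals_mset_of_factorization:
  assumes "char_poly A = (\<Prod>e\<leftarrow>es. [:- e, 1:])"
  shows "eigvals_mset A = mset es"
proof -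
  have "eigvals_mset A = sum_list (map (\<lambda>e. proots [:- e, 1:]) es)"
    unfolding eigvals_mset_def assms
    using proots_prod_list[of "map (\<lambda>e. [:- e, 1:]) es"] by (simp add: o_def image_iff)
  also have "\<dots> = mset es" by (induction es) auto
  finally show ?thesis .
qed

lemma size_eigvals_mset:
  assumes "A \<in> carrier_mat n n"
  shows "size (eigvals_mset A) = n"
  using degree_monic_char_poly[OF assms] by (simp add: eigvals_mset_def size_proots_complex)

text \<open>Indexing the eigenvalues by positions on the diagonal turns sums over eigenvalues into sums over the
columns of \<open>U\<close>.\<close>

lemma unitary_triangularization:
  assumes A: "A \<in> carrier_mat n n"
  obtains U B where "U \<in> carrier_mat n n" "B \<in> carrier_mat n n" "B = mat_adjoint U * A * U"
    "mat_adjoint U * U = 1\<^sub>m n" "U * mat_adjoint U = 1\<^sub>m n" "upper_triangular B"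
    "eigvals_mset A = image_mset (\<lambda>i. B $$ (i, i)) (mset [0..<n])"
proof -
  obtain es where es: "char_poly A = (\<Prod>e\<leftarrow>es. [:- e, 1:])"
    using char_poly_factorized[OF A] by blast
  obtain U where U: "U \<in> carrier_mat n n" "mat_adjoint U * U = 1\<^sub>m n"
    "upper_triangular (mat_adjoint U * A * U)" "diag_mat (mat_adjoint U * A * U) = es"
    using unitary_schur_decomposition[OF A es] by blast
  have U': "mat_adjoint U \<in> carrier_mat n n" using U by simp
  show thesis
  proof (rule that[of U "mat_adjoint U * A * U"])
    show "mat_adjoint U * A * U \<in> carrier_mat n n" using U(1) U' A by auto
    show "U * mat_adjoint U = 1\<^sub>m n" using mat_mult_left_right_inverse[OF U' U(1,2)] .
    show "eigvals_mset A = image_mset (\<lambda>i. (mat_adjoint U * A * U) $$ (i, i)) (mset [0..<n])"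
      unfolding eigvals_mset_of_factorization[OF es] U(4)[symmetric] diag_mat_def
      using U(1) by simp
  qed (use U in auto)
qed

lemma sum_eigvals_pow:
  assumes A: "A \<in> carrier_mat n n"
  shows "(\<Sum>z\<in>#eigvals_mset A. z ^ k) = mat_trace (A ^\<^sub>m k)"
proof -
  obtain U B where U: "U \<in> carrier_mat n n" and B: "B \<in> carrier_mat n n" and BU: "B = mat_adjoint U * A * U"
    and UU: "mat_adjoint U * U = 1\<^sub>m n" "U * mat_adjoint U = 1\<^sub>m n" and ut: "upper_triangular B"
    and ev: "eigvals_mset A = image_mset (\<lambda>i. B $$ (i, i)) (mset [0..<n])"
    using unitary_triangularization[OF A] by blast
  have "similar_mat_wit B A (mat_adjoint U) U"
    by (rule similar_mat_witI[of _ _ n]) (use U B A UU BU in auto)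
  then have "mat_trace (B ^\<^sub>m k) = mat_trace (A ^\<^sub>m k)"
    by (intro mat_trace_similar similar_mat_wit_pow)
  moreover have "mat_trace (B ^\<^sub>m k) = (\<Sum>i = 0..<n. (B $$ (i, i)) ^ k)"
    using upper_triangular_pow[OF B ut, of k] B by (simp add: mat_trace_def)
  ultimately show ?thesis
    by (simp add: ev image_mset.compositionality o_def sum_unfold_sum_mset)
qed

text \<open>The eigenvalues of \<open>A\<close> are \<open>\<langle>A u\<^sub>j, u\<^sub>j\<rangle>\<close> for the columns \<open>u\<^sub>j\<close> of a unitary matrix, and
\<open>\<langle>H u\<^sub>j, u\<^sub>j\<rangle>\<close> is real. What is left, \<open>\<langle>(A - H) u\<^sub>j, u\<^sub>j\<rangle>\<close>, is estimated entry by entry: after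
summation over \<open>j\<close>, the entry \<open>(p, q)\<close> is weighted by a sum of products of the rows \<open>p\<close> and \<open>q\<close> of
the unitary matrix, which is at most 1.\<close>

lemma sum_abs_Im_eigvals_le:
  assumes A: "A \<in> carrier_mat n n" and H: "H \<in> carrier_mat n n" "mat_adjoint H = H"
  shows "(\<Sum>z\<in>#eigvals_mset A. \<bar>Im z\<bar>) \<le> entry_norm (A - H)"
proof -
  obtain U B where U: "U \<in> carrier_mat n n" and B: "B \<in> carrier_mat n n" and BU: "B = mat_adjoint U * A * U"
    and UU: "U * mat_adjoint U = 1\<^sub>m n"
    and ev: "eigvals_mset A = image_mset (\<lambda>i. B $$ (i, i)) (mset [0..<n])"
    using unitary_triangularization[OF A] by blast
  define u where "u = (\<lambda>p j. U $$ (p, j))"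
  define E where "E = A - H"
  have E: "E \<in> carrier_mat n n" using minus_carrier_mat[OF H(1)] by (simp add: E_def)
  have form: "(mat_adjoint U * M * U) $$ (j, j) = (\<Sum>q = 0..<n. \<Sum>p = 0..<n. cnj (u p j) * M $$ (p, q) * u q j)"
    if M: "M \<in> carrier_mat n n" and j: "j < n" for M j
    using j U M unfolding u_def
    by (subst mult_mat_index[of _ n n _ n])
      (simp_all add: mult_mat_index[of _ n n _ n] sum_distrib_right mult_carrier_mat[of _ n n _ n] del: index_mult_mat(1))
  have row: "(\<Sum>j = 0..<n. (cmod (u p j))\<^sup>2) = 1" if "p < n" for p
  proof -
    have "complex_of_real (\<Sum>j = 0..<n. (cmod (u p j))\<^sup>2) = (\<Sum>j = 0..<n. u p j * cnj (u p j))"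
      by (simp only: of_real_sum complex_norm_square)
    also have "\<dots> = (U * mat_adjoint U) $$ (p, p)"
      using that U by (simp add: mult_mat_index[of _ n n _ n] u_def del: index_mult_mat(1))
    also have "\<dots> = 1" using that by (simp add: UU)
    finally show ?thesis by (metis of_real_eq_1_iff)
  qed
  have Hpq: "cnj (H $$ (p, q)) = H $$ (q, p)" if "p < n" "q < n" for p q
    using that H mat_adjoint_index[of q H p] by simp
  have Im_B: "\<bar>Im (B $$ (j, j))\<bar> \<le> (\<Sum>q = 0..<n. \<Sum>p = 0..<n. cmod (E $$ (p, q)) * (cmod (u p j) * cmod (u q j)))"
    if j: "j < n" for j
  proof -
    define h where "h = (\<Sum>q = 0..<n. \<Sum>p = 0..<n. cnj (u p j) * H $$ (p, q) * u q j)"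
    have "cnj h = (\<Sum>q = 0..<n. \<Sum>p = 0..<n. cnj (u q j) * H $$ (q, p) * u p j)"
      unfolding h_def by (simp add: cnj_sum Hpq ac_simps)
    also have "\<dots> = h" unfolding h_def by (rule sum.swap)
    finally have "Im h = 0" by (simp add: complex_eq_iff)
    moreover have "B $$ (j, j) - h = (\<Sum>q = 0..<n. \<Sum>p = 0..<n. cnj (u p j) * E $$ (p, q) * u q j)"
      unfolding BU form[OF A j] h_def using A H
      by (simp add: E_def sum_subtractf[symmetric] algebra_simps)
    ultimately have "\<bar>Im (B $$ (j, j))\<bar> = \<bar>Im (\<Sum>q = 0..<n. \<Sum>p = 0..<n. cnj (u p j) * E $$ (p, q) * u q j)\<bar>"
      by (metis diff_zero minus_complex.sel(2))
    also have "\<dots> \<le> cmod (\<Sum>q = 0..<n. \<Sum>p = 0..<n. cnj (u p j) * E $$ (p, q) * u q j)"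
      by (rule abs_Im_le_cmod)
    also have "\<dots> \<le> (\<Sum>q = 0..<n. \<Sum>p = 0..<n. cmod (E $$ (p, q)) * (cmod (u p j) * cmod (u q j)))"
      by (intro order_trans[OF norm_sum] sum_mono) (simp add: norm_mult ac_simps)
    finally show ?thesis .
  qed
  \<comment> \<open>Cauchy-Schwarz for two unit rows, in the form of the inequality between the means.\<close>
  have cs: "(\<Sum>j = 0..<n. cmod (u p j) * cmod (u q j)) \<le> 1" if "p < n" "q < n" for p q
  proof -
    have "cmod (u p j) * cmod (u q j) \<le> ((cmod (u p j))\<^sup>2 + (cmod (u q j))\<^sup>2) / 2" for j
      using sum_squares_bound[of "cmod (u p j)" "cmod (u q j)"] by simp
    then have "(\<Sum>j = 0..<n. cmod (u p j) * cmod (u q j))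
        \<le> (\<Sum>j = 0..<n. ((cmod (u p j))\<^sup>2 + (cmod (u q j))\<^sup>2) / 2)"
      by (intro sum_mono)
    also have "\<dots> = 1" using row that by (simp add: sum.distrib flip: sum_divide_distrib)
    finally show ?thesis .
  qed
  have "(\<Sum>z\<in>#eigvals_mset A. \<bar>Im z\<bar>) = (\<Sum>j = 0..<n. \<bar>Im (B $$ (j, j))\<bar>)"
    by (simp add: ev image_mset.compositionality o_def sum_unfold_sum_mset)
  also have "\<dots> \<le> (\<Sum>j = 0..<n. \<Sum>q = 0..<n. \<Sum>p = 0..<n. cmod (E $$ (p, q)) * (cmod (u p j) * cmod (u q j)))"
    using Im_B by (intro sum_mono) auto
  also have "\<dots> = (\<Sum>q = 0..<n. \<Sum>j = 0..<n. \<Sum>p = 0..<n. cmod (E $$ (p, q)) * (cmod (u p j) * cmod (u q j)))"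
    by (rule sum.swap)
  also have "\<dots> = (\<Sum>q = 0..<n. \<Sum>p = 0..<n. cmod (E $$ (p, q)) * (\<Sum>j = 0..<n. cmod (u p j) * cmod (u q j)))"
    unfolding sum_distrib_left by (intro sum.cong refl sum.swap)
  also have "\<dots> \<le> (\<Sum>q = 0..<n. \<Sum>p = 0..<n. cmod (E $$ (p, q)) * 1)"
    using cs by (intro sum_mono mult_left_mono) auto
  also have "\<dots> = entry_norm E"
    using E by (subst sum.swap) (simp add: entry_norm_def)
  finally show ?thesis unfolding E_def .
qed

text \<open>Compare the \<open>\<ell>\<^sup>1\<close> norms of both sides of the eigenvector equation.\<close>

lemma cmod_eigval_le_col_sums:
  assumes A: "A \<in> carrier_mat n n" and C: "col_sums_le A C" and z: "z \<in># eigvals_mset A"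
  shows "cmod z \<le> C"
proof -
  have "poly (char_poly A) z = 0"
    using z degree_monic_char_poly[OF A] by (cases "char_poly A = 0") (auto simp: eigvals_mset_def)
  then have "eigenvalue A z" using eigenvalue_root_char_poly[OF A] by simp
  then obtain v where v: "v \<in> carrier_vec n" "v \<noteq> 0\<^sub>v n" "A *\<^sub>v v = z \<cdot>\<^sub>v v"
    using A unfolding eigenvalue_def eigenvector_def by auto
  define x where "x = (\<lambda>i. vec_index v i)"
  have Av: "(\<Sum>j = 0..<n. A $$ (i, j) * x j) = z * x i" if "i < n" for i
  proof -
    have "vec_index (A *\<^sub>v v) i = vec_index (z \<cdot>\<^sub>v v) i" by (simp add: v(3))
    then show ?thesis using that A v(1) by (simp add: scalar_prod_def x_def)
  qed
  have "\<exists>i<n. x i \<noteq> 0"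
  proof (rule ccontr)
    assume "\<not> ?thesis"
    then have "v = 0\<^sub>v n" using v(1) by (intro eq_vecI) (auto simp: x_def)
    then show False using v(2) by simp
  qed
  then obtain i where i: "i < n" "x i \<noteq> 0" by blast
  have pos: "(\<Sum>i = 0..<n. cmod (x i)) > 0"
    by (rule sum_pos2[of _ i]) (use i in auto)
  have "cmod z * (\<Sum>i = 0..<n. cmod (x i)) = (\<Sum>i = 0..<n. cmod (\<Sum>j = 0..<n. A $$ (i, j) * x j))"
    by (simp add: sum_distrib_left Av norm_mult)
  also have "\<dots> \<le> (\<Sum>i = 0..<n. \<Sum>j = 0..<n. cmod (A $$ (i, j)) * cmod (x j))"
    by (intro sum_mono order_trans[OF norm_sum]) (simp add: norm_mult)
  also have "\<dots> = (\<Sum>j = 0..<n. (\<Sum>i = 0..<n. cmod (A $$ (i, j))) * cmod (x j))"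
    unfolding sum_distrib_right by (rule sum.swap)
  also have "\<dots> \<le> (\<Sum>j = 0..<n. C * cmod (x j))"
    using A C unfolding col_sums_le_def by (intro sum_mono mult_right_mono) auto
  also have "\<dots> = C * (\<Sum>i = 0..<n. cmod (x i))" by (simp add: sum_distrib_left)
  finally show ?thesis using pos by simp
qed

section \<open>Comparison of eigenvalue averages\<close>

text \<open>The polynomial is a Weierstrass approximation of \<open>F\<close> on the real segment. Off the axis the
error is controlled by uniform continuity within distance \<open>d\<close>, and farther away by its supremum
\<open>M\<close>, which is at most \<open>(M / d) |Im z|\<close> there. No such bound is possible with \<open>K = 0\<close>, since uniform
limits of polynomials on a disc are holomorphic in its interior.\<close>

lemma polynomial_approx_near_real_axis:
  fixes F :: "complex \<Rightarrow> complex"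
  assumes F: "continuous_on UNIV F" and e: "0 < e"
  obtains p :: "complex poly" and K :: real
    where "0 \<le> K" "\<And>z. cmod z \<le> R \<Longrightarrow> cmod (F z - poly p z) \<le> e + K * \<bar>Im z\<bar>"
proof -
  have "continuous_on {-R..R} (\<lambda>x. F (complex_of_real x))"
    by (intro continuous_on_compose2[OF F] continuous_intros) auto
  from Stone_Weierstrass_polynomial_function[OF compact_Icc this, of "e / 2"] e
  obtain g :: "real \<Rightarrow> complex" where g: "polynomial_function g"
    "\<And>x. x \<in> {-R..R} \<Longrightarrow> cmod (F (complex_of_real x) - g x) < e / 2"
    by auto
  have "real_polynomial_function (\<lambda>x. Re (g x))" "real_polynomial_function (\<lambda>x. Im (g x))"
    using g(1) unfolding polynomial_function_def o_def
    by (auto dest!: spec[of _ Re] spec[of _ Im] simp: bounded_linear_Re bounded_linear_Im)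
  then obtain a n b m where ab: "(\<lambda>x. Re (g x)) = (\<lambda>x. \<Sum>i\<le>n. a i * x ^ i)"
    "(\<lambda>x. Im (g x)) = (\<lambda>x. \<Sum>i\<le>m. b i * x ^ i)"
    unfolding real_polynomial_function_iff_sum by blast
  define p where "p = (\<Sum>i\<le>n. monom (complex_of_real (a i)) i) + (\<Sum>i\<le>m. monom (\<i> * complex_of_real (b i)) i)"
  have pg: "poly p (complex_of_real x) = g x" for x
  proof -
    have "poly p (complex_of_real x) = complex_of_real (\<Sum>i\<le>n. a i * x ^ i) + \<i> * complex_of_real (\<Sum>i\<le>m. b i * x ^ i)"
      by (simp add: p_def poly_sum poly_monom sum_distrib_left mult.assoc)
    also have "\<dots> = g x"
      unfolding fun_cong[OF ab(1), symmetric] fun_cong[OF ab(2), symmetric] by (simp add: complex_eq_iff)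
    finally show ?thesis .
  qed
  define G where "G = (\<lambda>z. F z - poly p z)"
  have G: "continuous_on (cball 0 R) G" unfolding G_def
    by (intro continuous_intros continuous_on_subset[OF F]) auto
  obtain M where M: "\<And>z. z \<in> cball 0 R \<Longrightarrow> cmod (G z) \<le> M" "0 < M"
    using compact_imp_bounded[OF compact_continuous_image[OF G compact_cball]]
    unfolding bounded_pos ball_simps by blast
  obtain d where d: "0 < d"
    "\<And>z w. z \<in> cball 0 R \<Longrightarrow> w \<in> cball 0 R \<Longrightarrow> dist w z < d \<Longrightarrow> dist (G w) (G z) < e / 2"
    using uniformly_continuous_onE[OF compact_uniformly_continuous[OF G compact_cball] half_gt_zero[OF e]]
    by metis
  show thesis
  proof (rule that[of "M / d" p])
    show "0 \<le> M / d" using M d by simp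
    fix z assume z: "cmod z \<le> R"
    show "cmod (F z - poly p z) \<le> e + M / d * \<bar>Im z\<bar>"
    proof (cases "\<bar>Im z\<bar> < d")
      case True
      define x where "x = complex_of_real (Re z)"
      have zx: "z - x = \<i> * complex_of_real (Im z)" by (simp add: x_def complex_eq_iff)
      have x: "\<bar>Re z\<bar> \<le> R" using z abs_Re_le_cmod[of z] by simp
      have "dist (G z) (G x) < e / 2"
        using True z x by (intro d) (auto simp: dist_norm zx norm_mult, simp add: x_def)
      moreover have "cmod (G x) < e / 2"
        using g(2)[of "Re z"] x by (simp add: G_def x_def pg abs_le_iff)
      ultimately have "cmod (G z) < e"
        using norm_triangle_sub[of "G z" "G x"] by (simp add: dist_norm)
      moreover have "0 \<le> M / d * \<bar>Im z\<bar>" using M d by simp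
      ultimately show ?thesis unfolding G_def by linarith
    next
      case False
      have "cmod (G z) \<le> M" using M z by simp
      also have "M * 1 \<le> M * (\<bar>Im z\<bar> / d)" using False M d by (intro mult_left_mono) auto
      finally show ?thesis using e unfolding G_def by simp
    qed
  qed
qed

lemma sum_mset_poly:
  fixes p :: "complex poly"
  shows "(\<Sum>z\<in>#M. poly p z) = (\<Sum>i\<le>degree p. coeff p i * (\<Sum>z\<in>#M. z ^ i))"
  by (induction M) (simp_all add: poly_altdef sum.distrib algebra_simps)

lemma sum_mset_subtractf:
  fixes f g :: "'a \<Rightarrow> 'b::ab_group_add"
  shows "(\<Sum>z\<in>#M. f z - g z) = (\<Sum>z\<in>#M. f z) - (\<Sum>z\<in>#M. g z)"
  by (induction M) (simp_all add: algebra_simps)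

lemma norm_sum_mset_le:
  fixes f :: "'a \<Rightarrow> complex"
  shows "cmod (\<Sum>z\<in>#M. f z) \<le> (\<Sum>z\<in>#M. cmod (f z))"
  by (induction M) (auto intro: order_trans[OF norm_triangle_ineq])

text \<open>Only the imaginary parts of the eigenvalues are summed here, so an error linear in \<open>|Im z|\<close> costs
no more than the distance of \<open>A\<close> to a Hermitian matrix.\<close>

lemma norm_sum_mset_eigvals_le:
  fixes f :: "complex \<Rightarrow> complex"
  assumes A: "A \<in> carrier_mat n n" and H: "H \<in> carrier_mat n n" "mat_adjoint H = H"
    and C: "col_sums_le A C"
    and f: "\<And>z. cmod z \<le> C \<Longrightarrow> cmod (f z) \<le> e + K * \<bar>Im z\<bar>" and K: "0 \<le> K"
  shows "cmod (\<Sum>z\<in>#eigvals_mset A. f z) \<le> real n * e + K * entry_norm (A - H)"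
proof -
  have "cmod (\<Sum>z\<in>#eigvals_mset A. f z) \<le> (\<Sum>z\<in>#eigvals_mset A. cmod (f z))"
    by (rule norm_sum_mset_le)
  also have "\<dots> \<le> (\<Sum>z\<in>#eigvals_mset A. e + K * \<bar>Im z\<bar>)"
    by (rule sum_mset_mono) (rule f[OF cmod_eigval_le_col_sums[OF A C]])
  also have "\<dots> = real n * e + K * (\<Sum>z\<in>#eigvals_mset A. \<bar>Im z\<bar>)"
    by (simp add: sum_mset.distrib sum_mset_distrib_left size_eigvals_mset[OF A] image_mset.compositionality o_def)
  also have "\<dots> \<le> real n * e + K * entry_norm (A - H)"
    using sum_abs_Im_eigvals_le[OF A H] K by (intro add_mono mult_left_mono) auto
  finally show ?thesis .
qed

text \<open>The comparison principle behind the distribution result. The entry sums of \<open>A n - H n\<close> are \<open>o(n)\<close>,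
so power sums of eigenvalues differ by \<open>o(n)\<close>, and the eigenvalues of \<open>A n\<close> are real up to a
total error \<open>o(n)\<close>; those of \<open>H n\<close> are real. Replacing \<open>F\<close> by a polynomial close to it on
the real axis therefore costs an arbitrarily small multiple of \<open>n\<close>.\<close>

theorem eigenvalue_averages_asymptotically_equal:
  fixes A H :: "nat \<Rightarrow> complex mat" and F :: "complex \<Rightarrow> complex"
  assumes A: "\<And>n. A n \<in> carrier_mat n n" and H: "\<And>n. H n \<in> carrier_mat n n"
    and herm: "\<And>n. mat_adjoint (H n) = H n"
    and C: "0 \<le> C" "\<And>n. row_sums_le (A n) C" "\<And>n. col_sums_le (A n) C" "\<And>n. col_sums_le (H n) C"
    and lim: "(\<lambda>n. entry_norm (A n - H n) / real n) \<longlonglongrightarrow> 0"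
    and F: "continuous_on UNIV F"
  shows "(\<lambda>n. ((\<Sum>z\<in>#eigvals_mset (A n). F z) - (\<Sum>z\<in>#eigvals_mset (H n). F z)) / of_nat n) \<longlonglongrightarrow> 0"
proof -
  define S where "S = (\<lambda>f :: complex \<Rightarrow> complex. \<lambda>n. (\<Sum>z\<in>#eigvals_mset (A n). f z) - (\<Sum>z\<in>#eigvals_mset (H n). f z))"
  have S_pow: "(\<lambda>n. S (\<lambda>z. z ^ k) n / of_nat n) \<longlonglongrightarrow> 0" for k
  proof (rule Lim_null_comparison)
    show "(\<lambda>n. real k * C ^ (k - 1) * (entry_norm (A n - H n) / real n)) \<longlonglongrightarrow> 0"
      using tendsto_mult_right_zero[OF lim] by simp
    show "\<forall>\<^sub>F n in sequentially. norm (S (\<lambda>z. z ^ k) n / of_nat n)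
        \<le> real k * C ^ (k - 1) * (entry_norm (A n - H n) / real n)"
    proof (intro always_eventually allI)
      fix n
      have "cmod (S (\<lambda>z. z ^ k) n) \<le> real k * C ^ (k - 1) * entry_norm (A n - H n)"
        unfolding S_def sum_eigvals_pow[OF A] sum_eigvals_pow[OF H]
        by (rule order_trans[OF mat_trace_diff_le[of _ n] entry_norm_pow_diff[of _ n]])
          (use A H C in auto)
      then show "norm (S (\<lambda>z. z ^ k) n / of_nat n) \<le> real k * C ^ (k - 1) * (entry_norm (A n - H n) / real n)"
        by (simp add: norm_divide divide_right_mono)
    qed
  qed
  have S_poly: "(\<lambda>n. S (poly p) n / of_nat n) \<longlonglongrightarrow> 0" for p
  proof -
    have "S (poly p) n / of_nat n = (\<Sum>i\<le>degree p. coeff p i * (S (\<lambda>z. z ^ i) n / of_nat n))" for n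
      by (simp add: S_def sum_mset_poly sum_subtractf[symmetric] sum_divide_distrib right_diff_distrib)
    moreover have "(\<lambda>n. \<Sum>i\<le>degree p. coeff p i * (S (\<lambda>z. z ^ i) n / of_nat n)) \<longlonglongrightarrow> 0"
      by (intro tendsto_null_sum tendsto_mult_right_zero S_pow)
    ultimately show ?thesis by simp
  qed
  have "(\<lambda>n. S F n / of_nat n) \<longlonglongrightarrow> 0"
  proof (rule tendstoI)
    fix r :: real assume r: "0 < r"
    obtain p K where K: "0 \<le> K" and p: "\<And>z. cmod z \<le> C \<Longrightarrow> cmod (F z - poly p z) \<le> r / 4 + K * \<bar>Im z\<bar>"
      using polynomial_approx_near_real_axis[OF F, of "r / 4" C] r by (metis divide_pos_pos zero_less_numeral)
    have "(\<lambda>n. K * (entry_norm (A n - H n) / real n) + cmod (S (poly p) n / of_nat n)) \<longlonglongrightarrow> 0"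
      by (intro tendsto_add_zero tendsto_mult_right_zero lim tendsto_norm_zero S_poly)
    then have "\<forall>\<^sub>F n in sequentially. K * (entry_norm (A n - H n) / real n) + cmod (S (poly p) n / of_nat n) < r / 2"
      using r by (intro order_tendstoD) auto
    then show "\<forall>\<^sub>F n in sequentially. dist (S F n / of_nat n) 0 < r"
      using eventually_gt_at_top[of 0]
    proof eventually_elim
      case (elim n)
      have "entry_norm (H n - H n) = 0" using H[of n] by (simp add: entry_norm_def)
      \<comment> \<open>For the Hermitian matrix itself the contribution of imaginary parts vanishes.\<close>
      then have DH: "cmod (\<Sum>z\<in>#eigvals_mset (H n). F z - poly p z) \<le> real n * (r / 4)"
        using norm_sum_mset_eigvals_le[OF H H herm C(4) p K, of n] by simp
      have DA: "cmod (\<Sum>z\<in>#eigvals_mset (A n). F z - poly p z) \<le> real n * (r / 4) + K * entry_norm (A n - H n)"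
        by (rule norm_sum_mset_eigvals_le[OF A H herm C(3) p K])
      define X Y where "X = (\<Sum>z\<in>#eigvals_mset (A n). F z - poly p z)"
        and "Y = (\<Sum>z\<in>#eigvals_mset (H n). F z - poly p z)"
      have "S F n = S (poly p) n + (X - Y)"
        by (simp add: S_def X_def Y_def sum_mset_subtractf)
      then have "cmod (S F n) \<le> cmod (S (poly p) n) + (cmod X + cmod Y)"
        by (auto intro!: order_trans[OF norm_triangle_ineq] add_left_mono norm_triangle_ineq4)
      also have "\<dots> \<le> cmod (S (poly p) n)
          + ((real n * (r / 4) + K * entry_norm (A n - H n)) + real n * (r / 4))"
        using DA DH unfolding X_def Y_def by (intro add_left_mono add_mono)
      finally have "cmod (S F n) \<le> cmod (S (poly p) n)
          + ((real n * (r / 4) + K * entry_norm (A n - H n)) + real n * (r / 4))" .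
      then have "cmod (S F n) / real n \<le> (cmod (S (poly p) n)
          + ((real n * (r / 4) + K * entry_norm (A n - H n)) + real n * (r / 4))) / real n"
        by (rule divide_right_mono) simp
      also have "\<dots> = K * (entry_norm (A n - H n) / real n) + cmod (S (poly p) n / of_nat n) + r / 2"
        using elim(2) by (simp add: norm_divide field_simps)
      finally have "cmod (S F n) / real n < r" using elim(1) by linarith
      then show ?case by (simp add: norm_divide)
    qed
  qed
  then show ?thesis by (simp add: S_def)
qed

section \<open>The free Jacobi matrix\<close>

lemma right_Riemann_sums_tendsto:
  fixes f :: "real \<Rightarrow> 'a::euclidean_space"
  assumes c: "0 < c" and f: "continuous_on {0..c} f"
  shows "(\<lambda>n. (c / real n) *\<^sub>R (\<Sum>j = 1..n. f (real j * (c / real n)))) \<longlonglongrightarrow> integral {0..c} f"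
proof (rule tendstoI)
  fix r :: real assume r: "0 < r"
  define e where "e = r / (2 * c)"
  have e: "0 < e" using r c by (simp add: e_def)
  obtain d where d: "0 < d"
    "\<And>x y. x \<in> {0..c} \<Longrightarrow> y \<in> {0..c} \<Longrightarrow> dist y x < d \<Longrightarrow> dist (f y) (f x) < e"
    using uniformly_continuous_onE[OF compact_uniformly_continuous[OF f compact_Icc] e] by metis
  have "(\<lambda>n. c / real n) \<longlonglongrightarrow> 0" by (rule lim_const_over_n)
  then have "\<forall>\<^sub>F n in sequentially. c / real n < d" using d(1) by (rule order_tendstoD)
  then show "\<forall>\<^sub>F n in sequentially. dist ((c / real n) *\<^sub>R (\<Sum>j = 1..n. f (real j * (c / real n)))) (integral {0..c} f) < r"
    using eventually_gt_at_top[of 0]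
  proof eventually_elim
    case (elim n)
    define h where "h = c / real n"
    have h: "0 < h" "h < d" "real n * h = c" using elim c by (auto simp: h_def)
    have "norm (h *\<^sub>R (\<Sum>j = 1..k. f (real j * h)) - integral {0..real k * h} f) \<le> e * (real k * h)"
      if "k \<le> n" for k
      using that
    proof (induction k)
      case (Suc k)
      let ?x = "real k * h" and ?y = "real (Suc k) * h"
      have "real (Suc k) * h \<le> real n * h" using Suc.prems h by (intro mult_right_mono) auto
      then have xy: "0 \<le> ?x" "?x \<le> ?y" "?y \<le> c" using h by (auto simp: algebra_simps)
      have yx: "?y - ?x = h" by (simp add: algebra_simps)
      have cont: "continuous_on {?x..?y} f" by (rule continuous_on_subset[OF f]) (use xy in auto)
      have int: "f integrable_on {0..?y}"
        by (intro integrable_continuous_interval continuous_on_subset[OF f]) (use xy in auto)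
      have "norm (integral {?x..?y} (\<lambda>t. f ?y - f t)) \<le> e * (?y - ?x)"
      proof (rule integral_bound)
        fix t assume t: "t \<in> {?x..?y}"
        have "0 \<le> t" using t order_trans[OF xy(1)] by simp
        then have "dist (f ?y) (f t) < e"
          using t xy h(1,2) yx by (intro d) (auto simp: dist_real_def)
        then show "norm (f ?y - f t) \<le> e" by (simp add: dist_norm)
      qed (use xy cont in \<open>auto intro!: continuous_intros\<close>)
      moreover have "integral {?x..?y} (\<lambda>t. f ?y - f t) = h *\<^sub>R f ?y - integral {?x..?y} f"
        using integral_diff[OF integrable_const_ivl integrable_continuous_interval[OF cont], of "f ?y"]
          integral_const_real[of ?x ?y "f ?y"] xy(2) yx by simp
      ultimately have step: "norm (h *\<^sub>R f ?y - integral {?x..?y} f) \<le> e * h"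
        using yx by simp
      have "integral {0..?y} f = integral {0..?x} f + integral {?x..?y} f"
        using Henstock_Kurzweil_Integration.integral_combine[OF xy(1,2) int] by simp
      then have "h *\<^sub>R (\<Sum>j = 1..Suc k. f (real j * h)) - integral {0..?y} f
          = (h *\<^sub>R (\<Sum>j = 1..k. f (real j * h)) - integral {0..?x} f) + (h *\<^sub>R f ?y - integral {?x..?y} f)"
        by (simp add: scaleR_add_right del: of_nat_Suc)
      then have "norm (h *\<^sub>R (\<Sum>j = 1..Suc k. f (real j * h)) - integral {0..?y} f)
          \<le> norm (h *\<^sub>R (\<Sum>j = 1..k. f (real j * h)) - integral {0..?x} f) + e * h"
        using step norm_triangle_ineq[of "h *\<^sub>R (\<Sum>j = 1..k. f (real j * h)) - integral {0..?x} f" "h *\<^sub>R f ?y - integral {?x..?y} f"]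
        by simp
      also have "\<dots> \<le> e * ?x + e * h" using Suc by auto
      finally show ?case by (simp add: algebra_simps)
    qed simp
    from this[of n] have "norm (h *\<^sub>R (\<Sum>j = 1..n. f (real j * h)) - integral {0..c} f) \<le> e * c"
      using h by simp
    also have "\<dots> < r" using r c by (simp add: e_def)
    finally show ?case by (simp add: dist_norm h_def)
  qed
qed

text \<open>The mesh \<open>j \<pi> / (n + 1)\<close> with \<open>1 \<le> j \<le> n\<close> omits the right endpoint of a Riemann sum of length
\<open>n + 1\<close>; both this and the normalization by \<open>n\<close> are corrections of order \<open>1 / n\<close>.\<close>

lemma interior_mesh_averages_tendsto:
  fixes f :: "real \<Rightarrow> complex"
  assumes f: "continuous_on {0..pi} f"
  shows "(\<lambda>n. (\<Sum>j = 1..n. f (real j * pi / real (Suc n))) / of_nat n) \<longlonglongrightarrow> integral {0..pi} f / of_real pi"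
proof -
  define R where "R = (\<lambda>n. (pi / real n) *\<^sub>R (\<Sum>j = 1..n. f (real j * (pi / real n))))"
  have R: "(\<lambda>n. R (Suc n)) \<longlonglongrightarrow> integral {0..pi} f"
    unfolding R_def by (rule LIMSEQ_Suc[OF right_Riemann_sums_tendsto[OF pi_gt_zero f]])
  have "(\<lambda>n. (real (Suc n) / real n) *\<^sub>R (R (Suc n) / of_real pi) - f pi / of_nat n)
      \<longlonglongrightarrow> 1 *\<^sub>R (integral {0..pi} f / of_real pi) - 0"
    by (intro tendsto_diff tendsto_scaleR tendsto_divide R tendsto_const lim_const_over_n LIMSEQ_Suc_n_over_n) simp
  moreover have "\<forall>\<^sub>F n in sequentially. (real (Suc n) / real n) *\<^sub>R (R (Suc n) / of_real pi) - f pi / of_nat n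
      = (\<Sum>j = 1..n. f (real j * pi / real (Suc n))) / of_nat n"
    using eventually_gt_at_top[of 0]
  proof eventually_elim
    case (elim n)
    have "R (Suc n) = (pi / real (Suc n)) *\<^sub>R ((\<Sum>j = 1..n. f (real j * pi / real (Suc n))) + f pi)"
      unfolding R_def by (simp del: of_nat_Suc)
    then have "R (Suc n) / of_real pi = (1 / real (Suc n)) *\<^sub>R ((\<Sum>j = 1..n. f (real j * pi / real (Suc n))) + f pi)"
      by (simp add: scaleR_conv_of_real del: of_nat_Suc)
    then have "(real (Suc n) / real n) *\<^sub>R (R (Suc n) / of_real pi)
        = (1 / real n) *\<^sub>R ((\<Sum>j = 1..n. f (real j * pi / real (Suc n))) + f pi)"
      by (simp del: of_nat_Suc)
    then have "(real (Suc n) / real n) *\<^sub>R (R (Suc n) / of_real pi)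
        = ((\<Sum>j = 1..n. f (real j * pi / real (Suc n))) + f pi) / of_nat n"
      by (simp only: scaleR_conv_of_real) simp
    then show ?case by (simp add: add_divide_distrib)
  qed
  ultimately show ?thesis by (auto elim: Lim_transform_eventually)
qed

abbreviation free_jacobi :: "nat \<Rightarrow> complex mat" where
  "free_jacobi \<equiv> leading_block (jacobi (\<lambda>_. 1) (\<lambda>_. 0) (\<lambda>_. 1))"

lemma leading_block_carrier [simp]: "leading_block M n \<in> carrier_mat n n"
  by (simp add: leading_block_def)

lemma leading_block_index [simp]: "i < n \<Longrightarrow> j < n \<Longrightarrow> leading_block M n $$ (i, j) = M i j"
  by (simp add: leading_block_def)

lemma leading_block_dims [simp]: "dim_row (leading_block M n) = n" "dim_col (leading_block M n) = n"
  by (simp_all add: leading_block_def)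

text \<open>The vectors \<open>sin (k t)\<close>, \<open>1 \<le> k \<le> n\<close>, satisfy the three-term recurrence with eigenvalue \<open>2 cos t\<close>, and
\<open>t = j \<pi> / (n + 1)\<close> makes them vanish at \<open>k = 0\<close> and \<open>k = n + 1\<close>, which are the boundary conditions
imposed by cutting off the infinite matrix.\<close>

lemma eigenvalue_free_jacobi:
  assumes j: "j \<in> {1..n}"
  shows "eigenvalue (free_jacobi n) (complex_of_real (2 * cos (real j * pi / real (Suc n))))"
proof -
  define t where "t = real j * pi / real (Suc n)"
  define s where "s = (\<lambda>k. complex_of_real (sin (real k * t)))"
  have t: "0 < t" "t < pi"
    using j mult_strict_right_mono[of "real j" "real (Suc n)" pi] by (auto simp: t_def divide_less_eq mult.commute)
  have s0: "s 0 = 0" by (simp add: s_def)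
  have "real (Suc n) * t = real j * pi" by (simp add: t_def)
  then have sn: "s (Suc n) = 0" by (simp add: s_def del: of_nat_Suc)
  have rec: "s p + s (Suc (Suc p)) = complex_of_real (2 * cos t) * s (Suc p)" for p
  proof -
    have "sin (real p * t) = sin (real (Suc p) * t - t)" "sin (real (Suc (Suc p)) * t) = sin (real (Suc p) * t + t)"
      by (simp_all add: algebra_simps)
    then have "sin (real p * t) + sin (real (Suc (Suc p)) * t) = 2 * cos t * sin (real (Suc p) * t)"
      by (simp add: sin_add sin_diff del: of_nat_Suc)
    then show ?thesis unfolding s_def by (metis of_real_add of_real_mult)
  qed
  define v where "v = Matrix.vec n (\<lambda>p. s (Suc p))"
  have v: "v \<in> carrier_vec n" by (simp add: v_def)
  have "free_jacobi n *\<^sub>v v = complex_of_real (2 * cos t) \<cdot>\<^sub>v v"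
  proof (rule eq_vecI)
    fix p assume "p < dim_vec (complex_of_real (2 * cos t) \<cdot>\<^sub>v v)"
    then have p: "p < n" by (simp add: v_def)
    have "vec_index (free_jacobi n *\<^sub>v v) p = (\<Sum>q = 0..<n. jacobi (\<lambda>_. 1) (\<lambda>_. 0) (\<lambda>_. 1) p q * s (Suc q))"
      using p by (simp add: scalar_prod_def v_def)
    also have "\<dots> = (\<Sum>q = 0..<n. (if q = p - 1 then if 0 < p then s p else 0 else 0)
        + (if q = Suc p then s (Suc (Suc p)) else 0))"
      by (intro sum.cong) (auto simp: jacobi_def)
    also have "\<dots> = s p + s (Suc (Suc p))"
      using p s0 sn by (cases "Suc p < n"; cases "p = 0") (auto simp: sum.distrib not_less le_Suc_eq dest: le_antisym)
    also have "\<dots> = vec_index (complex_of_real (2 * cos t) \<cdot>\<^sub>v v) p"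
      using p by (simp add: rec v_def)
    finally show "vec_index (free_jacobi n *\<^sub>v v) p = vec_index (complex_of_real (2 * cos t) \<cdot>\<^sub>v v) p" .
  qed (simp add: v_def)
  moreover have "v \<noteq> 0\<^sub>v n"
  proof
    assume "v = 0\<^sub>v n"
    then have "vec_index v 0 = 0" using j by simp
    then show False using j sin_gt_zero[OF t] by (simp add: v_def s_def)
  qed
  ultimately show ?thesis using v unfolding eigenvalue_def eigenvector_def t_def by auto
qed

text \<open>The \<open>n\<close> eigenvalues found above are distinct because the cosine is injective on \<open>[0, \<pi>]\<close>, so there is
no room for others or for multiplicities.\<close>

lemma eigvals_mset_free_jacobi:
  "eigvals_mset (free_jacobi n)
    = image_mset (\<lambda>j. complex_of_real (2 * cos (real j * pi / real (Suc n)))) (mset_set {1..n})"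
proof -
  define l where "l = (\<lambda>j. complex_of_real (2 * cos (real j * pi / real (Suc n))))"
  have inj: "inj_on l {1..n}"
  proof (rule inj_onI)
    fix i j assume ij: "i \<in> {1..n}" "j \<in> {1..n}" "l i = l j"
    have range: "0 \<le> real k * pi / real (Suc n)" "real k * pi / real (Suc n) \<le> pi" if "k \<in> {1..n}" for k
      using that mult_right_mono[of "real k" "real (Suc n)" pi] by (auto simp: divide_le_eq mult.commute)
    have "cos (real i * pi / real (Suc n)) = cos (real j * pi / real (Suc n))"
      using ij(3) unfolding l_def of_real_eq_iff by linarith
    then have "real i * pi / real (Suc n) = real j * pi / real (Suc n)"
      by (rule cos_inj_pi[OF range[OF ij(1)] range[OF ij(2)]])
    then show "i = j" by (simp del: of_nat_Suc)
  qed
  let ?E = "eigvals_mset (free_jacobi n)"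
  have T: "free_jacobi n \<in> carrier_mat n n" by (rule leading_block_carrier)
  have "char_poly (free_jacobi n) \<noteq> 0"
    using degree_monic_char_poly[OF T] by auto
  then have mem: "l j \<in># ?E" if "j \<in> {1..n}" for j
    using eigenvalue_free_jacobi[OF that] eigenvalue_root_char_poly[OF T]
    by (simp add: l_def eigvals_mset_def)
  have "mset_set (l ` {1..n}) \<subseteq># ?E"
    unfolding subseteq_mset_def using mem by (auto simp: count_mset_set' Suc_le_eq)
  moreover have "size (mset_set (l ` {1..n})) = size ?E"
    unfolding size_mset_set card_image[OF inj] size_eigvals_mset[OF T] by simp
  then have "\<not> mset_set (l ` {1..n}) \<subset># ?E"
    using mset_subset_size[of "mset_set (l ` {1..n})" ?E] by (metis less_irrefl)
  ultimately have "mset_set (l ` {1..n}) = ?E"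
    unfolding subset_mset.less_le by blast
  then show ?thesis using image_mset_mset_set[OF inj] unfolding l_def by simp
qed

section \<open>Clustering and attraction from the distribution\<close>

lemma eigval_distributed_real_test:
  fixes g :: "complex \<Rightarrow> real"
  assumes dist: "eigval_distributed A \<theta> G"
    and g: "continuous_on UNIV g" "bounded {z. g z \<noteq> 0}"
  shows "(\<lambda>n. (\<Sum>z\<in>#eigvals_mset (A n). g z) / real n)
      \<longlonglongrightarrow> (LINT t|lebesgue_on G. g (\<theta> t)) / measure lebesgue G"
proof -
  let ?F = "\<lambda>z. complex_of_real (g z)"
  have "continuous_on UNIV ?F" "bounded {z. ?F z \<noteq> 0}" using g by (auto intro: continuous_intros)
  then have lim: "(\<lambda>n. (1 / of_nat n) * (\<Sum>z\<in>#eigvals_mset (A n). ?F z))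
      \<longlonglongrightarrow> (1 / of_real (measure lebesgue G)) * (LINT t|lebesgue_on G. ?F (\<theta> t))"
    using dist unfolding eigval_distributed_def by blast
  have sumF: "(\<Sum>z\<in>#M. ?F z) = of_real (\<Sum>z\<in>#M. g z)" for M by (induction M) auto
  have real: "(1 / of_nat n) * complex_of_real x = complex_of_real (x / real n)"
    "(1 / of_real y) * complex_of_real x = complex_of_real (x / y)" for n x y by simp_all
  show ?thesis
    using lim unfolding sumF integral_complex_of_real real tendsto_of_real_iff .
qed

lemma eigval_distributed_measure_pos:
  "eigval_distributed A \<theta> G \<Longrightarrow> 0 < measure lebesgue G"
  unfolding eigval_distributed_def measure_def enn2real_positive_iff by auto

text \<open>The tent \<open>max 0 (1 - dist(z, S) / \<epsilon>)\<close> is 1 on \<open>S\<close>, so its limiting average is 1, and 1 minus the tent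
is nonnegative and equals 1 at each eigenvalue outside the \<open>\<epsilon>\<close>-neighbourhood. Compactness of \<open>S\<close> gives the tent
bounded support.\<close>

lemma weakly_clustered_if_distributed:
  assumes dist: "eigval_distributed A \<theta> G" and A: "\<And>n. A n \<in> carrier_mat n n"
    and S: "compact S" "S \<noteq> {}" and \<theta>: "\<And>t. t \<in> G \<Longrightarrow> \<theta> t \<in> S"
  shows "weakly_clustered A S"
  unfolding weakly_clustered_def
proof (intro conjI allI impI)
  show "S \<noteq> {}" "closed S" using S compact_imp_closed by auto
  fix \<epsilon> :: real assume \<epsilon>: "0 < \<epsilon>"
  define g where "g = (\<lambda>z. max 0 (1 - infdist z S / \<epsilon>))"
  have "continuous_on UNIV g" unfolding g_def using \<epsilon> by (intro continuous_intros) auto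
  moreover have "bounded {z. g z \<noteq> 0}"
  proof -
    obtain B where B: "\<And>s. s \<in> S \<Longrightarrow> cmod s \<le> B"
      using compact_imp_bounded[OF S(1)] unfolding bounded_iff by blast
    have "cmod z \<le> B + \<epsilon>" if "g z \<noteq> 0" for z
    proof -
      have "infdist z S < \<epsilon>" using that \<epsilon> by (auto simp: g_def max_def field_simps split: if_splits)
      moreover obtain s where "s \<in> S" "infdist z S = dist z s"
        using infdist_attains_inf[OF \<open>closed S\<close> S(2)] by blast
      ultimately show ?thesis using B[of s] norm_triangle_sub[of z s] by (simp add: dist_norm)
    qed
    then show ?thesis unfolding bounded_iff by blast
  qed
  ultimately have lim: "(\<lambda>n. (\<Sum>z\<in>#eigvals_mset (A n). g z) / real n)
      \<longlonglongrightarrow> (LINT t|lebesgue_on G. g (\<theta> t)) / measure lebesgue G"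
    by (rule eigval_distributed_real_test[OF dist])
  have G: "G \<in> sets lebesgue" using dist unfolding eigval_distributed_def by auto
  have "(LINT t|lebesgue_on G. g (\<theta> t)) = (LINT t|lebesgue_on G. 1)"
    using \<theta> G by (intro Bochner_Integration.integral_cong) (auto simp: g_def)
  also have "\<dots> = measure lebesgue G" using G by (simp add: measure_restrict_space)
  finally have "(\<lambda>n. (\<Sum>z\<in>#eigvals_mset (A n). g z) / real n) \<longlonglongrightarrow> 1"
    using lim eigval_distributed_measure_pos[OF dist] by simp
  then have "(\<lambda>n. 1 - (\<Sum>z\<in>#eigvals_mset (A n). g z) / real n) \<longlonglongrightarrow> 1 - 1"
    by (intro tendsto_diff tendsto_const)
  then have "(\<lambda>n. 1 - (\<Sum>z\<in>#eigvals_mset (A n). g z) / real n) \<longlonglongrightarrow> 0" by simp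
  moreover have "size {#z \<in># M. z \<notin> nbhd S \<epsilon>#} \<le> real (size M) - (\<Sum>z\<in>#M. g z)" for M
  proof (induction M)
    case (add z M)
    have "g z \<le> 1" using \<epsilon> infdist_nonneg[of z S] by (simp add: g_def)
    moreover have "g z = 0" if "z \<notin> nbhd S \<epsilon>"
    proof -
      obtain s where "s \<in> S" "infdist z S = dist z s"
        using infdist_attains_inf[OF \<open>closed S\<close> S(2)] by blast
      then have "\<epsilon> \<le> infdist z S" using that by (auto simp: nbhd_def dist_norm not_less)
      then show ?thesis using \<epsilon> by (simp add: g_def)
    qed
    ultimately show ?case using add by auto
  qed simp
  then have count: "size {#z \<in># eigvals_mset (A n). z \<notin> nbhd S \<epsilon>#} \<le> real n - (\<Sum>z\<in>#eigvals_mset (A n). g z)" for n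
    using size_eigvals_mset[OF A] by metis
  have "\<forall>\<^sub>F n in sequentially. norm (real (size {#z \<in># eigvals_mset (A n). z \<notin> nbhd S \<epsilon>#}) / real n)
      \<le> 1 - (\<Sum>z\<in>#eigvals_mset (A n). g z) / real n"
    using eventually_gt_at_top[of 0]
  proof eventually_elim
    case (elim n)
    then show ?case
      using divide_right_mono[OF count[of n], of "real n"] by (simp add: diff_divide_distrib)
  qed
  ultimately have "(\<lambda>n. real (size {#z \<in># eigvals_mset (A n). z \<notin> nbhd S \<epsilon>#}) / real n) \<longlonglongrightarrow> 0"
    by (rule Lim_null_comparison[rotated])
  then show "(\<lambda>n. real (size {#z \<in># eigvals_mset (A n). z \<notin> nbhd S \<epsilon>#})) \<in> o(\<lambda>n. real n)"
    by (rule smalloI_tendsto) (use eventually_gt_at_top[of 0] in \<open>auto elim!: eventually_mono\<close>)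
qed

text \<open>The hypothesis on the tent around \<open>s\<close> says that \<open>s\<close> lies in the essential range of \<open>\<theta>\<close>. The tent is at
most 1, so a positive limiting average \<open>m\<close> forces more than \<open>(m / 2) n\<close> eigenvalues into the
\<open>\<epsilon>\<close>-disc around \<open>s\<close>. If the entry at position \<open>j\<close> of the sorted list were outside, at most \<open>j\<close>
eigenvalues could be inside.\<close>

lemma strongly_attracts_if_distributed:
  assumes dist: "eigval_distributed A \<theta> G"
    and pos: "\<And>\<epsilon>. 0 < \<epsilon> \<Longrightarrow> 0 < (LINT t|lebesgue_on G. max 0 (1 - cmod (\<theta> t - s) / \<epsilon>))"
  shows "strongly_attracts_inf s A"
  unfolding strongly_attracts_inf_def
proof (intro allI impI)
  fix L :: "nat \<Rightarrow> complex list" and j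
  assume L: "\<forall>n. mset (L n) = eigvals_mset (A n) \<and> sorted (map (\<lambda>z. cmod (z - s)) (L n))"
  show "(\<lambda>n. cmod (L n ! j - s)) \<longlonglongrightarrow> 0"
  proof (rule tendstoI)
    fix \<epsilon> :: real assume \<epsilon>: "0 < \<epsilon>"
    define g where "g = (\<lambda>z. max 0 (1 - cmod (z - s) / \<epsilon>))"
    define m where "m = (LINT t|lebesgue_on G. g (\<theta> t)) / measure lebesgue G"
    have "continuous_on UNIV g" unfolding g_def using \<epsilon> by (intro continuous_intros) auto
    moreover have "bounded {z. g z \<noteq> 0}"
    proof -
      have "cmod z \<le> cmod s + \<epsilon>" if "g z \<noteq> 0" for z
      proof -
        have "cmod (z - s) < \<epsilon>" using that \<epsilon> by (auto simp: g_def max_def field_simps split: if_splits)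
        then show ?thesis using norm_triangle_sub[of z s] by simp
      qed
      then show ?thesis unfolding bounded_iff by blast
    qed
    ultimately have "(\<lambda>n. (\<Sum>z\<in>#eigvals_mset (A n). g z) / real n) \<longlonglongrightarrow> m"
      unfolding m_def by (rule eigval_distributed_real_test[OF dist])
    moreover have m: "0 < m"
      using eigval_distributed_measure_pos[OF dist] pos[OF \<epsilon>] by (simp add: m_def g_def)
    ultimately have "\<forall>\<^sub>F n in sequentially. m / 2 < (\<Sum>z\<in>#eigvals_mset (A n). g z) / real n"
      by (intro order_tendstoD) auto
    moreover have "\<forall>\<^sub>F n in sequentially. real j / (m / 2) < real n"
      by (rule eventually_compose_filterlim[OF eventually_gt_at_top filterlim_real_sequentially])
    ultimately show "\<forall>\<^sub>F n in sequentially. dist (cmod (L n ! j - s)) 0 < \<epsilon>"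
      using eventually_gt_at_top[of 0]
    proof eventually_elim
      case (elim n)
      have "real j < m / 2 * real n" using elim(2) m by (simp add: field_simps)
      also have "\<dots> < (\<Sum>z\<in>#eigvals_mset (A n). g z)"
        using elim(1,3) by (subst (asm) pos_less_divide_eq) auto
      also have "\<dots> = (\<Sum>z\<leftarrow>L n. g z)"
        unfolding L[rule_format, THEN conjunct1, symmetric] by (simp flip: mset_map add: sum_mset_sum_list)
      also have "\<dots> = (\<Sum>i = 0..<length (L n). g (L n ! i))"
        by (simp add: sum_list_sum_nth)
      finally have big: "real j < (\<Sum>i = 0..<length (L n). g (L n ! i))" .
      have g1: "g z \<le> 1" for z using \<epsilon> by (simp add: g_def)
      show ?case
      proof (rule ccontr)
        assume "\<not> ?thesis"
        then have far: "\<epsilon> \<le> cmod (L n ! j - s)" by simp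
        have "g (L n ! i) = 0" if "j \<le> i" "i < length (L n)" for i
        proof -
          have "cmod (L n ! j - s) \<le> cmod (L n ! i - s)"
            using L[rule_format, of n] that sorted_nth_mono[of "map (\<lambda>z. cmod (z - s)) (L n)" j i] by simp
          then show ?thesis using far \<epsilon> by (simp add: g_def)
        qed
        then have "(\<Sum>i = 0..<length (L n). g (L n ! i)) = (\<Sum>i \<in> {0..<length (L n)} \<inter> {0..<j}. g (L n ! i))"
          by (intro sum.mono_neutral_right) auto
        also have "\<dots> \<le> (\<Sum>i \<in> {0..<length (L n)} \<inter> {0..<j}. 1)"
          by (intro sum_mono g1)
        also have "\<dots> \<le> real j"
          using card_mono[of "{0..<j}" "{0..<length (L n)} \<inter> {0..<j}"] by simp
        finally show False using big by simp
      qed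
    qed
  qed
qed

section \<open>Jacobi matrices close to the free one\<close>

lemma sum_delta_le:
  fixes x :: real and k :: nat
  assumes "0 \<le> x"
  shows "(\<Sum>j = 0..<n. if j = k then x else 0) \<le> x"
  using assms by simp

text \<open>The entry \<open>a i\<close> lies left of the diagonal, so it occurs only from the second row on.\<close>

lemma row_sum_jacobi_le:
  "(\<Sum>j = 0..<n. cmod (jacobi a b c i j))
    \<le> cmod (b i) + (if i = 0 then 0 else cmod (a i)) + cmod (c (Suc i))"
proof -
  have "(\<Sum>j = 0..<n. cmod (jacobi a b c i j)) \<le> (\<Sum>j = 0..<n. (if j = i then cmod (b i) else 0)
      + (if j = i - 1 then if i = 0 then 0 else cmod (a i) else 0) + (if j = Suc i then cmod (c (Suc i)) else 0))"
    by (intro sum_mono) (auto simp: jacobi_def)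
  also have "\<dots> \<le> cmod (b i) + (if i = 0 then 0 else cmod (a i)) + cmod (c (Suc i))"
    unfolding sum.distrib by (intro add_mono sum_delta_le) auto
  finally show ?thesis .
qed

lemma jacobi_swap: "jacobi a b c j i = jacobi c b a i j"
  by (auto simp: jacobi_def)

lemma row_col_sums_jacobi_le:
  assumes "\<And>k. cmod (a k) \<le> C" "\<And>k. cmod (b k) \<le> C" "\<And>k. cmod (c k) \<le> C"
  shows "row_sums_le (leading_block (jacobi a b c) n) (3 * C)"
    and "col_sums_le (leading_block (jacobi a b c) n) (3 * C)"
proof -
  have *: "(\<Sum>j = 0..<n. cmod (jacobi a b c i j)) \<le> 3 * C"
    if "\<And>k. cmod (a k) \<le> C" "\<And>k. cmod (b k) \<le> C" "\<And>k. cmod (c k) \<le> C" for a b c i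
  proof -
    have "0 \<le> C" using that(1)[of 0] norm_ge_zero order_trans by blast
    then show ?thesis
      using row_sum_jacobi_le[where n = n and a = a and b = b and c = c and i = i] that(1)[of i] that(2)[of i] that(3)[of "Suc i"]
      by (auto split: if_splits)
  qed
  show "row_sums_le (leading_block (jacobi a b c) n) (3 * C)"
    unfolding row_sums_le_def using *[of a b c] assms by simp
  show "col_sums_le (leading_block (jacobi a b c) n) (3 * C)"
    unfolding col_sums_le_def using *[of c b a] assms by (simp add: jacobi_swap[of a])
qed

lemma entry_norm_jacobi_minus_free_le:
  "entry_norm (leading_block (jacobi a b c) n - free_jacobi n)
    \<le> cmod (b 0) + (\<Sum>j = 1..n. cmod (1 - a j) + cmod (b j) + cmod (1 - c j))"
proof -
  let ?r = "\<lambda>i. cmod (b i) + (if i = 0 then 0 else cmod (1 - a i))"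
  have diff: "(leading_block (jacobi a b c) n - free_jacobi n) $$ (i, j)
      = jacobi (\<lambda>k. a k - 1) b (\<lambda>k. c k - 1) i j" if "i < n" "j < n" for i j
    using that by (simp add: jacobi_def)
  have "entry_norm (leading_block (jacobi a b c) n - free_jacobi n)
      = (\<Sum>i = 0..<n. \<Sum>j = 0..<n. cmod (jacobi (\<lambda>k. a k - 1) b (\<lambda>k. c k - 1) i j))"
    unfolding entry_norm_def by (intro sum.cong) (simp_all add: diff del: index_minus_mat(1))
  also have "\<dots> \<le> (\<Sum>i = 0..<n. ?r i + cmod (1 - c (Suc i)))"
    by (intro sum_mono order_trans[OF row_sum_jacobi_le]) (simp add: norm_minus_commute)
  also have "\<dots> = (\<Sum>i = 0..<n. ?r i) + (\<Sum>j = 1..n. cmod (1 - c j))"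
    by (simp add: sum.distrib sum.atLeast1_atMost_eq atLeast0LessThan)
  also have "\<dots> \<le> (\<Sum>i = 0..n. ?r i) + (\<Sum>j = 1..n. cmod (1 - c j))"
    by (intro add_right_mono sum_mono2) auto
  also have "(\<Sum>i = 0..n. ?r i) = cmod (b 0) + (\<Sum>i = 1..n. ?r i)"
    by (subst sum.atLeast_Suc_atMost) auto
  also have "(\<Sum>i = 1..n. ?r i) = (\<Sum>i = 1..n. cmod (b i) + cmod (1 - a i))"
    by (intro sum.cong) auto
  finally show ?thesis by (simp add: sum.distrib algebra_simps)
qed

lemma lebesgue_integral_cos_symmetric:
  fixes F :: "complex \<Rightarrow> complex"
  assumes F: "continuous_on UNIV F"
  shows "(LINT t|lebesgue_on {-pi..pi}. F (complex_of_real (2 * cos t)))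
    = 2 * integral {0..pi} (\<lambda>t. F (complex_of_real (2 * cos t)))"
proof -
  let ?f = "\<lambda>t. F (complex_of_real (2 * cos t))"
  have cont: "continuous_on S ?f" for S
    by (intro continuous_on_compose2[OF F] continuous_intros) auto
  have "(LINT t|lebesgue_on {-pi..pi}. ?f t) = integral {-pi..pi} ?f"
    by (intro lebesgue_integral_eq_integral continuous_imp_integrable_real cont) simp
  also have "\<dots> = integral {-pi..0} ?f + integral {0..pi} ?f"
    by (rule Henstock_Kurzweil_Integration.integral_combine[symmetric])
      (use integrable_continuous_interval[OF cont] in simp_all)
  also have "integral {-pi..0} ?f = integral {0..pi} ?f"
    using Henstock_Kurzweil_Integration.integral_reflect_real[of pi 0 ?f] by simp
  finally show ?thesis by simp
qed

text \<open>The entry sum of the perturbation exceeds the sum in the hypothesis by at most \<open>|b 0|\<close>, which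
vanishes after division by \<open>n\<close>; the bounded entries supply the uniform row and column sums.\<close>

theorem eigval_distributed_jacobi:
  assumes bdd: "bdd_above (range (\<lambda>n. cmod (a n) + cmod (b n) + cmod (c n)))"
    and lim: "(\<lambda>n. (1 / real n) * (\<Sum>j=1..n. cmod (1 - a j) + cmod (b j) + cmod (1 - c j))) \<longlonglongrightarrow> 0"
  shows "eigval_distributed (leading_block (jacobi a b c)) (\<lambda>t. complex_of_real (2 * cos t)) {-pi..pi}"
  unfolding eigval_distributed_def
proof (intro conjI allI impI)
  show "{-pi..pi} \<in> sets lebesgue" by simp
  show "0 < emeasure lebesgue {-pi..pi}" "emeasure lebesgue {-pi..pi} < \<infinity>" by simp_all
  show "(\<lambda>t. complex_of_real (2 * cos t)) \<in> borel_measurable (lebesgue_on {-pi..pi})"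
    by (intro continuous_imp_measurable_on_sets_lebesgue continuous_intros) simp
  fix F :: "complex \<Rightarrow> complex" assume F: "continuous_on UNIV F"
  let ?A = "leading_block (jacobi a b c)" and ?f = "\<lambda>t. F (complex_of_real (2 * cos t))"
  obtain M where M: "\<And>n. cmod (a n) + cmod (b n) + cmod (c n) \<le> M"
    using bdd unfolding bdd_above_def by auto
  define C where "C = max 1 M"
  have abc: "cmod (a n) \<le> C" "cmod (b n) \<le> C" "cmod (c n) \<le> C" for n
    using M[of n] norm_ge_zero[of "a n"] norm_ge_zero[of "b n"] norm_ge_zero[of "c n"] unfolding C_def by linarith+
  have "(\<lambda>n. entry_norm (?A n - free_jacobi n) / real n) \<longlonglongrightarrow> 0"
  proof (rule Lim_null_comparison)
    show "(\<lambda>n. cmod (b 0) / real n + (1 / real n) * (\<Sum>j=1..n. cmod (1 - a j) + cmod (b j) + cmod (1 - c j))) \<longlonglongrightarrow> 0"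
      by (intro tendsto_add_zero lim lim_const_over_n)
    show "\<forall>\<^sub>F n in sequentially. norm (entry_norm (?A n - free_jacobi n) / real n)
        \<le> cmod (b 0) / real n + (1 / real n) * (\<Sum>j=1..n. cmod (1 - a j) + cmod (b j) + cmod (1 - c j))"
    proof (intro always_eventually allI)
      fix n
      show "norm (entry_norm (?A n - free_jacobi n) / real n)
        \<le> cmod (b 0) / real n + (1 / real n) * (\<Sum>j=1..n. cmod (1 - a j) + cmod (b j) + cmod (1 - c j))"
        using divide_right_mono[OF entry_norm_jacobi_minus_free_le[of a b c n], of "real n"] entry_norm_nonneg
        by (simp add: add_divide_distrib)
    qed
  qed
  then have 1: "(\<lambda>n. ((\<Sum>z\<in>#eigvals_mset (?A n). F z) - (\<Sum>z\<in>#eigvals_mset (free_jacobi n). F z)) / of_nat n) \<longlonglongrightarrow> 0"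
  proof (rule eigenvalue_averages_asymptotically_equal[rotated 7, where C = "3 * C"])
    show "mat_adjoint (free_jacobi n) = free_jacobi n" for n
      by (rule eq_matI) (auto simp: jacobi_def)
    show "row_sums_le (?A n) (3 * C)" "col_sums_le (?A n) (3 * C)" for n
      by (intro row_col_sums_jacobi_le abc)+
    show "col_sums_le (free_jacobi n) (3 * C)" for n
      by (intro row_col_sums_jacobi_le) (simp_all add: C_def)
  qed (use F in \<open>simp_all add: C_def\<close>)
  have "(\<lambda>n. (\<Sum>j = 1..n. ?f (real j * pi / real (Suc n))) / of_nat n) \<longlonglongrightarrow> integral {0..pi} ?f / of_real pi"
    by (intro interior_mesh_averages_tendsto continuous_on_compose2[OF F] continuous_intros) auto
  moreover have "(\<Sum>z\<in>#eigvals_mset (free_jacobi n). F z) = (\<Sum>j = 1..n. ?f (real j * pi / real (Suc n)))" for n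
    unfolding eigvals_mset_free_jacobi by (simp add: image_mset.compositionality o_def sum_unfold_sum_mset)
  ultimately have 2: "(\<lambda>n. (\<Sum>z\<in>#eigvals_mset (free_jacobi n). F z) / of_nat n) \<longlonglongrightarrow> integral {0..pi} ?f / of_real pi"
    by simp
  have "(\<lambda>n. (\<Sum>z\<in>#eigvals_mset (?A n). F z) / of_nat n) \<longlonglongrightarrow> integral {0..pi} ?f / of_real pi"
    using tendsto_add[OF 1 2] by (simp add: diff_divide_distrib)
  moreover have "(1 / of_real (measure lebesgue {-pi..pi})) * (LINT t|lebesgue_on {-pi..pi}. ?f t)
      = integral {0..pi} ?f / of_real pi"
    unfolding lebesgue_integral_cos_symmetric[OF F] by simp
  ultimately show "(\<lambda>n. (1 / of_nat n) * (\<Sum>z\<in>#eigvals_mset (?A n). F z))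
      \<longlonglongrightarrow> (1 / of_real (measure lebesgue {-pi..pi})) * (LINT t|lebesgue_on {-pi..pi}. ?f t)"
    by (simp only: times_divide_eq_left mult_1_left)
qed

text \<open>The tent is continuous and equals 1 at \<open>t\<close>, so every value of a continuous function on an interval
lies in its essential range.\<close>

lemma lebesgue_integral_bump_pos:
  fixes \<theta> :: "real \<Rightarrow> complex"
  assumes \<theta>: "continuous_on {u..v} \<theta>" and "u < v" and t: "t \<in> {u..v}" and \<epsilon>: "0 < \<epsilon>"
  shows "0 < (LINT x|lebesgue_on {u..v}. max 0 (1 - cmod (\<theta> x - \<theta> t) / \<epsilon>))"
proof -
  let ?g = "\<lambda>x. max 0 (1 - cmod (\<theta> x - \<theta> t) / \<epsilon>)"
  have cont: "continuous_on {u..v} ?g" using \<epsilon> by (intro continuous_intros \<theta>) auto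
  have eq: "(LINT x|lebesgue_on {u..v}. ?g x) = integral {u..v} ?g"
    by (intro lebesgue_integral_eq_integral continuous_imp_integrable_real cont) simp
  have "0 \<le> integral {u..v} ?g"
    by (intro Henstock_Kurzweil_Integration.integral_nonneg integrable_continuous_interval cont) simp
  moreover have "integral {u..v} ?g \<noteq> 0"
    using integral_eq_0_iff[of u v ?g] cont \<open>u < v\<close> t by force
  ultimately show ?thesis unfolding eq by simp
qed

theorem corollary3p7:
  fixes a b c :: "nat \<Rightarrow> complex" and A :: "nat \<Rightarrow> complex mat"
  assumes bounded_entries: "bdd_above (range (\<lambda>n. cmod (a n) + cmod (b n) + cmod (c n)))"
    and A_def: "\<And>n. A n = leading_block (jacobi a b c) n"
    and mean_lim: "(\<lambda>n. (1 / real n) * (\<Sum>j=1..n. cmod (1 - a j) + cmod (b j) + cmod (1 - c j)))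
                     \<longlonglongrightarrow> 0"
  shows "eigval_distributed A (\<lambda>t::real. complex_of_real (2 * cos t)) {-pi..pi}
       \<and> weakly_clustered A (complex_of_real ` {-2..2})
       \<and> (\<forall>s \<in> complex_of_real ` {-2..2}. strongly_attracts_inf s A)"
proof (intro conjI ballI)
  have "A = leading_block (jacobi a b c)" using A_def by (simp add: fun_eq_iff)
  then show dist: "eigval_distributed A (\<lambda>t::real. complex_of_real (2 * cos t)) {-pi..pi}"
    using eigval_distributed_jacobi[OF bounded_entries mean_lim] by simp
  show "weakly_clustered A (complex_of_real ` {-2..2})"
  proof (rule weakly_clustered_if_distributed[OF dist])
    show "compact (complex_of_real ` {-2..2})"
      by (intro compact_continuous_image continuous_intros compact_Icc)
    show "complex_of_real (2 * cos t) \<in> complex_of_real ` {-2..2}" for t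
      using cos_ge_minus_one[of t] cos_le_one[of t] by (intro imageI) auto
  qed (auto simp: A_def)
  fix s assume "s \<in> complex_of_real ` {-2..2}"
  then obtain x where x: "s = complex_of_real x" "-2 \<le> x" "x \<le> 2" by auto
  define t where "t = arccos (x / 2)"
  have t: "complex_of_real (2 * cos t) = s" "t \<in> {-pi..pi}"
    using x arccos_lbound[of "x / 2"] arccos_ubound[of "x / 2"] by (simp_all add: t_def)
  show "strongly_attracts_inf s A"
  proof (rule strongly_attracts_if_distributed[OF dist])
    fix \<epsilon> :: real assume "0 < \<epsilon>"
    then show "0 < (LINT t|lebesgue_on {-pi..pi}. max 0 (1 - cmod (complex_of_real (2 * cos t) - s) / \<epsilon>))"
      unfolding t(1)[symmetric] using t(2)
      by (intro lebesgue_integral_bump_pos continuous_intros) simp_all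
  qed
qed

end
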